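(* Let $\omega_1,\dots,\omega_{2N}$ be Majorana operators on the Fock space $\mathcal F$ of $N$ fermionic modes, $\{\omega_j,\omega_k\}=2\delta_{jk}$, and let $H_M=\frac{\mathrm i}{4}\sum_{\alpha,\beta=1}^{2N}\omega_\alpha (h_M)_{\alpha\beta}\omega_\beta$ with $h_M$ a real antisymmetric $2N\times 2N$ matrix. Suppose $\{1,\dots,2N\}=A\sqcup B$ with $|A|,|B|$ even, $|A|\ge|B|$, and $(h_M)_{\alpha\beta}=0$ unless one of $\alpha,\beta$ lies in $A$ and the other in $B$. Then there exists an orthonormal basis $\{|E_s\rangle\}_{s\in\{0,1\}^N}$ of $\mathcal F$ consisting of pure Gaussian eigenstates of $H_M$ such that for every $s$ the reduced state of $|E_s\rangle$ on the fermionic modes built from the Majorana operators in $B$ is maximally mixed; equivalently its covariance matrix restricted to $B$ vanishes, $(\Gamma_s)_{jk}=0$ for all $j,k\in B$, and $S(B|E_s)=|B|/2$ (the number of fermionic modes in $B$). In particular every energy eigenstate in this basis is maximally entangled between $A$ and $B$.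
   Context: Majorana operators may be obtained from fermionic modes via $\omega_{2j-1}=f_j^\dagger+f_j$, $\omega_{2j}=-\mathrm i(f_j^\dagger-f_j)$; conversely, pairing up the (even number of) Majorana operators in a set $B$ defines $|B|/2$ fermionic modes, and the algebra they generate is the algebra generated by $\{\omega_j\}_{j\in B}$. Gaussian states are states satisfying Wick's theorem; they are determined by the real antisymmetric covariance matrix $\Gamma_{jk}=\frac{\mathrm i}{2}\operatorname{Tr}(\rho[\omega_j,\omega_k])$. The reduced state on $B$ is the restriction of the state to the algebra generated by $\{\omega_j\}_{j\in B}$, and its covariance matrix is the submatrix $(\Gamma_{jk})_{j,k\in B}$. Entropy $S$ is the von Neumann entropy in units of $\log 2$ (logarithm base 2). *)

theory Defs
  imports "Jordan_Normal_Form.Char_Poly"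
begin

(* Conventions: N fermionic modes; Fock space = C^(2^N) (complex column vectors of
   dimension 2^N); Majorana operators indexed 0 .. 2N-1 (paper: 1 .. 2N). *)

definition fock_dim :: "nat \<Rightarrow> nat" where
  "fock_dim N = 2 ^ N"

definition majorana_family :: "nat \<Rightarrow> (nat \<Rightarrow> complex mat) \<Rightarrow> bool" where
  "majorana_family N \<omega> \<longleftrightarrow>
     (\<forall>j<2*N. \<omega> j \<in> carrier_mat (fock_dim N) (fock_dim N)) \<and>
     (\<forall>j<2*N. \<forall>r<fock_dim N. \<forall>c<fock_dim N. \<omega> j $$ (r,c) = cnj (\<omega> j $$ (c,r))) \<and>
     (\<forall>j<2*N. \<forall>k<2*N. \<omega> j * \<omega> k + \<omega> k * \<omega> j =
         (if j = k then 2 else 0) \<cdot>\<^sub>m 1\<^sub>m (fock_dim N))"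

definition majorana_hamiltonian ::
  "nat \<Rightarrow> (nat \<Rightarrow> complex mat) \<Rightarrow> (nat \<Rightarrow> nat \<Rightarrow> real) \<Rightarrow> complex mat" where
  "majorana_hamiltonian N \<omega> h =
     mat (fock_dim N) (fock_dim N)
       (\<lambda>(r,c). (\<i> / 4) * (\<Sum>\<alpha><2*N. \<Sum>\<beta><2*N.
                   complex_of_real (h \<alpha> \<beta>) * ((\<omega> \<alpha> * \<omega> \<beta>) $$ (r,c))))"

definition mono_list :: "nat \<Rightarrow> (nat \<Rightarrow> complex mat) \<Rightarrow> nat list \<Rightarrow> complex mat" where
  "mono_list N \<omega> js = foldr (\<lambda>j M. \<omega> j * M) js (1\<^sub>m (fock_dim N))"

definition mono :: "nat \<Rightarrow> (nat \<Rightarrow> complex mat) \<Rightarrow> nat set \<Rightarrow> complex mat" where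
  "mono N \<omega> S = mono_list N \<omega> (sorted_list_of_set S)"

definition expect :: "complex vec \<Rightarrow> complex mat \<Rightarrow> complex" where
  "expect \<psi> X = conjugate \<psi> \<bullet> (X *\<^sub>v \<psi>)"

definition mtrace :: "complex mat \<Rightarrow> complex" where
  "mtrace M = (\<Sum>i<dim_row M. M $$ (i,i))"

(* Pfaffian of the antisymmetric array (f a b)_{a,b in xs}, by expansion along
   the first row; odd size gives 0, empty gives 1 *)
function pf :: "(nat \<Rightarrow> nat \<Rightarrow> complex) \<Rightarrow> nat list \<Rightarrow> complex" where
  "pf f [] = 1"
| "pf f (a # xs) =
     (\<Sum>j<length xs. (-1) ^ j * f a (xs ! j) * pf f (take j xs @ drop (Suc j) xs))"
  by pat_completeness auto
termination
  by (relation "measure (\<lambda>(f, xs). length xs)") auto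

definition covariance ::
  "(nat \<Rightarrow> complex mat) \<Rightarrow> complex vec \<Rightarrow> nat \<Rightarrow> nat \<Rightarrow> complex" where
  "covariance \<omega> \<psi> j k = (\<i> / 2) * expect \<psi> (\<omega> j * \<omega> k - \<omega> k * \<omega> j)"

(* Gaussian state (Wick's theorem): every ordered monomial expectation is the
   Pfaffian of the two-point function <omega_a omega_b>, a < b (odd moments vanish) *)
definition gaussian_state :: "nat \<Rightarrow> (nat \<Rightarrow> complex mat) \<Rightarrow> complex vec \<Rightarrow> bool" where
  "gaussian_state N \<omega> \<psi> \<longleftrightarrow>
     (\<forall>S. S \<subseteq> {..<2*N} \<longrightarrow>
        expect \<psi> (mono N \<omega> S) =
        pf (\<lambda>a b. expect \<psi> (\<omega> a * \<omega> b)) (sorted_list_of_set S))"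

definition pure_gaussian :: "nat \<Rightarrow> (nat \<Rightarrow> complex mat) \<Rightarrow> complex vec \<Rightarrow> bool" where
  "pure_gaussian N \<omega> \<psi> \<longleftrightarrow>
     \<psi> \<in> carrier_vec (fock_dim N) \<and> \<psi> \<bullet>c \<psi> = 1 \<and> gaussian_state N \<omega> \<psi>"

(* the reduced state of psi on the algebra generated by {omega_j}_{j in B}
   is maximally mixed (= the normalized trace on that algebra) *)
definition reduced_maximally_mixed ::
  "nat \<Rightarrow> (nat \<Rightarrow> complex mat) \<Rightarrow> nat set \<Rightarrow> complex vec \<Rightarrow> bool" where
  "reduced_maximally_mixed N \<omega> B \<psi> \<longleftrightarrow>
     (\<forall>S. S \<subseteq> B \<longrightarrow> expect \<psi> (mono N \<omega> S) = mtrace (mono N \<omega> S) / of_nat (fock_dim N))"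

definition in_algebra :: "nat \<Rightarrow> (nat \<Rightarrow> complex mat) \<Rightarrow> nat set \<Rightarrow> complex mat \<Rightarrow> bool" where
  "in_algebra N \<omega> B X \<longleftrightarrow>
     (\<exists>c. X = mat (fock_dim N) (fock_dim N)
                 (\<lambda>(r,k). \<Sum>S\<in>Pow B. c S * (mono N \<omega> S $$ (r,k))))"

(* canonical trace on the algebra A_B = M_{2^{|B|/2}} (x) 1 (minimal projections
   have trace 1): tr_B X = 2^(|B|/2 - N) Tr X *)
definition alg_trace :: "nat \<Rightarrow> nat set \<Rightarrow> complex mat \<Rightarrow> complex" where
  "alg_trace N B X = of_real (2 powr (real (card B div 2) - real N)) * mtrace X"

definition reduced_density ::
  "nat \<Rightarrow> (nat \<Rightarrow> complex mat) \<Rightarrow> nat set \<Rightarrow> complex vec \<Rightarrow> complex mat \<Rightarrow> bool" where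
  "reduced_density N \<omega> B \<psi> \<rho> \<longleftrightarrow>
     in_algebra N \<omega> B \<rho> \<and>
     (\<forall>X. in_algebra N \<omega> B X \<longrightarrow> alg_trace N B (\<rho> * X) = expect \<psi> X)"

definition eig_xlogx :: "complex mat \<Rightarrow> real" where
  "eig_xlogx M = (\<Sum>\<nu>\<in>{\<nu>. poly (char_poly M) \<nu> = 0}.
      real (order \<nu> (char_poly M)) * (Re \<nu> * log 2 (Re \<nu>)))"

(* von Neumann entropy (base 2) S(B|psi) = - tr_B (rho log2 rho) *)
definition reduced_entropy_is ::
  "nat \<Rightarrow> (nat \<Rightarrow> complex mat) \<Rightarrow> nat set \<Rightarrow> complex vec \<Rightarrow> real \<Rightarrow> bool" where
  "reduced_entropy_is N \<omega> B \<psi> s \<longleftrightarrow>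
     (\<exists>\<rho>. reduced_density N \<omega> B \<psi> \<rho> \<and>
          s = - (2 powr (real (card B div 2) - real N)) * eig_xlogx \<rho>)"

end

(* The real block h_AB has a singular value decomposition. Its singular vectors, together with
   the |A| - |B| unmatched left singular vectors, give an orthogonal change of Majorana
   operators omega -> gamma, paired as (gamma_2k, gamma_2k+1) with gamma_2k built from A only,
   in which H_M = 1/2 sum_k e_k Z_k, where Z_k = i gamma_2k gamma_2k+1 are commuting Hermitian
   involutions. For every choice of signs z_k there is a unit vector with Z_k E = z_k E for
   all k; different signs give orthogonal vectors. Such a vector satisfies
   omega_a E = i sum_b J_ab omega_b E with J = sum_k z_k (gamma_2k wedge gamma_2k+1), so half of
   omega_a annihilates E, half annihilates E from the left, and anticommuting the
   annihilator through a monomial gives the Pfaffian recursion, i.e. Wick's theorem.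
   J vanishes on B x B since no gamma_2k has a component in B; hence all nontrivial monomials
   in B have expectation 0, as under the normalized trace. *)
theory Submission
  imports Defs
begin

section \<open>Singular value decomposition of real matrices\<close>

text \<open>The surplus of A can be paired within itself because |A| + |B| = 2N makes |A| - |B|
  even, and |A| >= |B| lets the first member of every pair lie in A. No dimension of a joint
  eigenspace is ever computed: \<open>\<gamma> (2*k)\<close> anticommutes with \<open>Z k\<close>
  and commutes with all other \<open>Z l\<close>, so it flips one sign and keeps the rest, and every
  one of the 2^N sign patterns occurs. The 2^N orthonormal vectors then fill a space of dimension
  2^N and form a basis. Degenerate energies do no harm, since the vectors are selected by the signs
  of the \<open>Z k\<close> and not by their energy. Gaussianity is derived from a linear relation
  satisfied by the state, in place of a density operator written as the exponential of a quadratic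
  form.\<close>

definition orthogonal_mat :: "nat \<Rightarrow> real mat \<Rightarrow> bool" where
  "orthogonal_mat n U \<longleftrightarrow> U \<in> carrier_mat n n \<and>
     transpose_mat U * U = 1\<^sub>m n \<and> U * transpose_mat U = 1\<^sub>m n"

lemma orthogonal_matD:
  assumes "orthogonal_mat n U"
  shows "U \<in> carrier_mat n n" "transpose_mat U \<in> carrier_mat n n"
    "transpose_mat U * U = 1\<^sub>m n" "U * transpose_mat U = 1\<^sub>m n"
  using assms by (auto simp: orthogonal_mat_def)

lemma orthogonal_mat_one: "orthogonal_mat n (1\<^sub>m n)"
  by (auto simp: orthogonal_mat_def)

lemma orthogonal_mat_mult:
  assumes "orthogonal_mat n U" "orthogonal_mat n V"
  shows "orthogonal_mat n (U * V)"
proof -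
  note u = orthogonal_matD[OF assms(1)] and v = orthogonal_matD[OF assms(2)]
  have t: "transpose_mat (U * V) = transpose_mat V * transpose_mat U"
    by (rule transpose_mult[OF u(1) v(1)])
  have "transpose_mat V * transpose_mat U * (U * V)
      = transpose_mat V * (transpose_mat U * U * V)"
    using u(1,2) v(1,2) by (smt (verit) assoc_mult_mat mult_carrier_mat)
  moreover have "U * V * (transpose_mat V * transpose_mat U)
      = U * (V * transpose_mat V * transpose_mat U)"
    using u(1,2) v(1,2) by (smt (verit) assoc_mult_mat mult_carrier_mat)
  ultimately show ?thesis
    unfolding orthogonal_mat_def t using u v by auto
qed

text \<open>The reflection in the hyperplane orthogonal to y - e_0 exchanges the two unit vectors
  e_0 and y. For y = e_0 that difference vanishes, and the identity serves instead.\<close>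

lemma orthogonal_mat_householder:
  fixes y :: "real vec"
  assumes y: "y \<in> carrier_vec (Suc n)" "y \<bullet> y = 1"
  obtains V where "orthogonal_mat (Suc n) V" "V *\<^sub>v unit_vec (Suc n) 0 = y"
proof (cases "y = unit_vec (Suc n) 0")
  case True
  then show ?thesis using that[OF orthogonal_mat_one] by simp
next
  case False
  let ?m = "Suc n"
  define w where "w = y - unit_vec ?m 0"
  have wc: "w \<in> carrier_vec ?m" using y by (simp add: w_def)
  define s where "s = w \<bullet> w"
  have w0: "w $ 0 = y $ 0 - 1" using y by (simp add: w_def)
  have s_sum: "s = (\<Sum>i<?m. w $ i * w $ i)"
    using wc unfolding s_def scalar_prod_def by (simp add: atLeast0LessThan del: sum.lessThan_Suc)
  have yy: "(\<Sum>i<n. y $ Suc i * y $ Suc i) = 1 - y $ 0 * y $ 0"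
    using y unfolding scalar_prod_def
    by (simp add: atLeast0LessThan sum.lessThan_Suc_shift del: sum.lessThan_Suc)
  have s: "s = 2 - 2 * y $ 0"
    unfolding s_sum using y yy
    by (simp add: w_def sum.lessThan_Suc_shift algebra_simps del: sum.lessThan_Suc)
  have "w \<noteq> 0\<^sub>v ?m"
  proof
    assume "w = 0\<^sub>v ?m"
    then have "y $ i = unit_vec ?m 0 $ i" if "i < ?m" for i
      using that y wc by (metis (no_types, lifting) carrier_vecD eq_iff_diff_eq_0 index_minus_vec(1)
          index_unit_vec(3) index_zero_vec(1) w_def)
    then show False using False y by (metis carrier_vecD eq_vecI index_unit_vec(3))
  qed
  then have s0: "s \<noteq> 0" using conjugate_square_eq_0_vec[OF wc]
    unfolding s_def vec_conjugate_real by simp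
  define V where "V = mat ?m ?m (\<lambda>(i,j). (if i = j then 1 else 0) - 2 / s * (w $ i * w $ j))"
  have Vc: "V \<in> carrier_mat ?m ?m" by (simp add: V_def)
  have VT: "transpose_mat V = V" by (rule eq_matI) (auto simp: V_def)
  have "V * V = 1\<^sub>m ?m"
  proof (rule eq_matI)
    fix i j assume ij: "i < dim_row (1\<^sub>m ?m :: real mat)" "j < dim_col (1\<^sub>m ?m :: real mat)"
    have "(V * V) $$ (i,j) = (\<Sum>k<?m. V $$ (i,k) * V $$ (k,j))"
      using ij Vc by (simp add: scalar_prod_def atLeast0LessThan del: sum.lessThan_Suc)
    \<comment> \<open>Expansion of the square of 1 - (2/s) w w^T. The last summand adds up to a
      multiple of w . w = s, and then cancels the two cross terms.\<close>
    also have "\<dots> = (\<Sum>k<?m. (if k = i then if i = j then 1 else 0 else 0)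
        - (if k = i then 2 / s * (w $ i * w $ j) else 0)
        - (if k = j then 2 / s * (w $ i * w $ j) else 0)
        + (2 / s)\<^sup>2 * (w $ i * w $ j) * (w $ k * w $ k))"
      using ij by (intro sum.cong) (auto simp: V_def algebra_simps power2_eq_square)
    also have "\<dots> = (if i = j then 1 else 0) - 2 * (2 / s * (w $ i * w $ j))
        + (2 / s)\<^sup>2 * (w $ i * w $ j) * s"
      using ij unfolding s_sum
      by (simp add: sum.distrib sum_subtractf sum_distrib_left[symmetric] del: sum.lessThan_Suc)
    also have "\<dots> = (if i = j then 1 else 0)"
      using s0 by (simp add: power2_eq_square field_simps)
    finally show "(V * V) $$ (i,j) = 1\<^sub>m ?m $$ (i,j)" using ij by simp
  qed (use Vc in auto)
  then have "orthogonal_mat ?m V" using Vc VT by (simp add: orthogonal_mat_def)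
  moreover have "V *\<^sub>v unit_vec ?m 0 = y"
  proof (rule eq_vecI)
    fix i assume i: "i < dim_vec y"
    \<comment> \<open>Unit length of \<open>y\<close> gives s = -2 w_0, so the first column e_0 -
      (2/s) w_0 w of \<open>V\<close> is e_0 + w = y.\<close>
    have c: "2 / s * w $ 0 = - 1" using s0 unfolding w0 using s by (simp add: field_simps)
    have "(V *\<^sub>v unit_vec ?m 0) $ i = V $$ (i, 0)" using i y Vc by simp
    also have "\<dots> = (if i = 0 then 1 else 0) - w $ i * (2 / s * w $ 0)"
      using i y by (simp add: V_def)
    also have "\<dots> = y $ i" unfolding c using i y by (simp add: w_def unit_vec_def)
    finally show "(V *\<^sub>v unit_vec ?m 0) $ i = y $ i" .
  qed (use y Vc in auto)
  ultimately show ?thesis using that by blast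
qed

section \<open>Existence of a pair of singular vectors\<close>

lemma real_vec_normalize:
  fixes v :: "real vec"
  assumes v: "v \<in> carrier_vec n" "v \<noteq> 0\<^sub>v n"
  obtains c where "c > 0" "(c \<cdot>\<^sub>v v) \<bullet> (c \<cdot>\<^sub>v v) = 1" "c\<^sup>2 * (v \<bullet> v) = 1"
proof -
  have "v \<bullet> v > 0"
    using conjugate_square_greater_0_vec[OF v(1)] v(2) unfolding vec_conjugate_real by simp
  then show ?thesis
    using that[of "1 / sqrt (v \<bullet> v)"] v
    by (simp add: power2_eq_square field_simps smult_scalar_prod_distrib[of _ n])
qed

text \<open>A complex root of the characteristic polynomial exists by the fundamental theorem of
  algebra, and symmetry makes it real. The eigenvector equation then holds separately for the real
  and the imaginary part, one of which is nonzero.\<close>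

lemma real_symmetric_eigenvector:
  fixes G :: "real mat"
  assumes G: "G \<in> carrier_mat n n" "transpose_mat G = G" and n: "n > 0"
  obtains v \<mu> where "v \<in> carrier_vec n" "v \<noteq> 0\<^sub>v n" "G *\<^sub>v v = \<mu> \<cdot>\<^sub>v v"
proof -
  let ?C = "map_mat complex_of_real G"
  have C: "?C \<in> carrier_mat n n" using G by simp
  have "degree (char_poly ?C) = n" using degree_monic_char_poly[OF C] by simp
  then obtain l where "poly (char_poly ?C) l = 0"
    using n fundamental_theorem_of_algebra[of "char_poly ?C"] by (auto simp: constant_degree)
  then have "eigenvalue ?C l" using eigenvalue_root_char_poly[OF C] by simp
  then obtain z where z: "z \<in> carrier_vec n" "z \<noteq> 0\<^sub>v n" "?C *\<^sub>v z = l \<cdot>\<^sub>v z"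
    using C unfolding eigenvalue_def eigenvector_def by auto
  have sum_eq: "(\<Sum>k<n. G $$ (i,k) * z $ k) = l * z $ i" if "i < n" for i
  proof -
    have "(?C *\<^sub>v z) $ i = (\<Sum>k<n. G $$ (i,k) * z $ k)"
      using that C G z(1) by (simp add: scalar_prod_def atLeast0LessThan)
    then show ?thesis using z(1,3) that by simp
  qed
  have sym: "G $$ (i,k) = G $$ (k,i)" if "i < n" "k < n" for i k
    using G that by (metis carrier_matD index_transpose_mat(1))
  \<comment> \<open>The quadratic form of a real symmetric matrix is real at every complex vector.\<close>
  define q where "q = (\<Sum>i<n. \<Sum>k<n. cnj (z $ i) * (G $$ (i,k) * z $ k))"
  have q1: "q = l * (\<Sum>i<n. cnj (z $ i) * z $ i)"
  proof -
    have "(\<Sum>k<n. cnj (z $ i) * (G $$ (i,k) * z $ k)) = l * (cnj (z $ i) * z $ i)"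
      if "i < n" for i
      unfolding sum_distrib_left[symmetric] sum_eq[OF that] by (simp add: mult_ac)
    then show ?thesis unfolding q_def by (simp add: sum_distrib_left)
  qed
  have "cnj q = (\<Sum>i<n. \<Sum>k<n. cnj (z $ k) * (G $$ (k,i) * z $ i))"
    unfolding q_def by (auto intro!: sum.cong simp: sym)
  also have "\<dots> = q" unfolding q_def by (rule sum.swap)
  finally have q2: "cnj q = q" .
  define p where "p = (\<Sum>i<n. (cmod (z $ i))\<^sup>2)"
  have p: "(\<Sum>i<n. cnj (z $ i) * z $ i) = complex_of_real p"
    unfolding p_def of_real_sum
    by (intro sum.cong refl) (simp only: complex_norm_square mult.commute)
  have "p \<noteq> 0"
  proof
    assume "p = 0"
    then have "\<forall>i<n. z $ i = 0" unfolding p_def by (subst (asm) sum_nonneg_eq_0_iff) auto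
    then show False using z by (metis carrier_vecD eq_vecI index_zero_vec)
  qed
  then have "cnj l = l" using q1 q2 unfolding p by simp
  then have l: "Im l = 0" by (simp add: complex_eq_iff)
  have re: "(\<Sum>k<n. G $$ (i,k) * Re (z $ k)) = Re l * Re (z $ i)"
    and im: "(\<Sum>k<n. G $$ (i,k) * Im (z $ k)) = Re l * Im (z $ i)" if "i < n" for i
    using arg_cong[OF sum_eq[OF that], of Re] arg_cong[OF sum_eq[OF that], of Im] l
    by simp_all
  have ev: "G *\<^sub>v vec n f = Re l \<cdot>\<^sub>v vec n f" if "\<And>i. i < n \<Longrightarrow> (\<Sum>k<n. G $$ (i,k) * f k) = Re l * f i" for f
    using G that by (intro eq_vecI) (auto simp: scalar_prod_def atLeast0LessThan)
  obtain i where i: "i < n" "z $ i \<noteq> 0" using z by (metis carrier_vecD eq_vecI index_zero_vec)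
  show ?thesis
  proof (cases "Re (z $ i) = 0")
    case False
    then have "vec n (\<lambda>k. Re (z $ k)) \<noteq> 0\<^sub>v n" using i by (metis index_vec index_zero_vec(1))
    then show ?thesis using that[OF _ _ ev[of "\<lambda>k. Re (z $ k)"]] re by simp
  next
    case True
    then have "Im (z $ i) \<noteq> 0" using i by (auto simp: complex_eq_iff)
    then have "vec n (\<lambda>k. Im (z $ k)) \<noteq> 0\<^sub>v n" using i by (metis index_vec index_zero_vec(1))
    then show ?thesis using that[OF _ _ ev[of "\<lambda>k. Im (z $ k)"]] im by simp
  qed
qed

text \<open>Padding \<open>M\<close> with zero columns gives a square matrix, possible because
  \<open>n \<le> m\<close>; its determinant vanishes together with that of its transpose. This
  supplies the left singular vector for the singular value 0.\<close>

lemma kernel_transpose_nontrivial: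
  fixes M :: "real mat"
  assumes M: "M \<in> carrier_mat m n" and "n \<le> m"
    and y: "y \<in> carrier_vec n" "y \<noteq> 0\<^sub>v n" "M *\<^sub>v y = 0\<^sub>v m"
  obtains x where "x \<in> carrier_vec m" "x \<noteq> 0\<^sub>v m" "transpose_mat M *\<^sub>v x = 0\<^sub>v n"
proof -
  define W where "W = mat m m (\<lambda>(i,j). if j < n then M $$ (i,j) else 0)"
  have W: "W \<in> carrier_mat m m" by (simp add: W_def)
  define y' where "y' = vec m (\<lambda>j. if j < n then y $ j else 0)"
  have "W *\<^sub>v y' = 0\<^sub>v m"
  proof (rule eq_vecI)
    fix i assume "i < dim_vec (0\<^sub>v m :: real vec)"
    then have i: "i < m" by simp
    have "(W *\<^sub>v y') $ i = (\<Sum>j<m. if j < n then M $$ (i,j) * y $ j else 0)"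
      using i by (auto simp: W_def y'_def scalar_prod_def atLeast0LessThan intro!: sum.cong)
    also have "\<dots> = (\<Sum>j<n. M $$ (i,j) * y $ j)"
      using \<open>n \<le> m\<close> by (intro sum.mono_neutral_cong_right) auto
    also have "\<dots> = (M *\<^sub>v y) $ i"
      using i M y(1) by (simp add: scalar_prod_def atLeast0LessThan)
    finally show "(W *\<^sub>v y') $ i = 0\<^sub>v m $ i" using y(3) by simp
  qed (simp add: W_def)
  moreover have "y' \<noteq> 0\<^sub>v m"
  proof
    assume "y' = 0\<^sub>v m"
    then have "y' $ j = 0" if "j < n" for j using that \<open>n \<le> m\<close> by simp
    then have "y $ j = 0" if "j < n" for j using that \<open>n \<le> m\<close> by (simp add: y'_def)
    then show False using y by (metis carrier_vecD eq_vecI index_zero_vec)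
  qed
  ultimately have "det W = 0"
    using det_0_iff_vec_prod_zero_field[OF W] by (metis vec_carrier y'_def)
  then have "det (transpose_mat W) = 0" using det_transpose[OF W] by simp
  then obtain x where x: "x \<in> carrier_vec m" "x \<noteq> 0\<^sub>v m" "transpose_mat W *\<^sub>v x = 0\<^sub>v m"
    using det_0_iff_vec_prod_zero_field[of "transpose_mat W" m] W by auto
  have "transpose_mat M *\<^sub>v x = 0\<^sub>v n"
  proof (rule eq_vecI)
    fix j assume "j < dim_vec (0\<^sub>v n :: real vec)"
    then have j: "j < n" "j < m" using \<open>n \<le> m\<close> by auto
    have "(transpose_mat M *\<^sub>v x) $ j = (transpose_mat W *\<^sub>v x) $ j"
      using j M x(1) W by (auto simp: scalar_prod_def W_def intro!: sum.cong)
    then show "(transpose_mat M *\<^sub>v x) $ j = 0\<^sub>v n $ j" using x(3) j by simp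
  qed (use M in auto)
  then show ?thesis using that x by blast
qed

text \<open>Take y as a unit eigenvector of M^T M and x as the normalized M y. If M y = 0 this gives
  no x, which is then taken from the kernel of M^T with \<sigma> = 0.\<close>

lemma singular_pair:
  fixes M :: "real mat"
  assumes M: "M \<in> carrier_mat m n" and "n \<le> m" "n > 0"
  obtains x y \<sigma> where "x \<in> carrier_vec m" "y \<in> carrier_vec n" "x \<bullet> x = 1" "y \<bullet> y = 1"
    "M *\<^sub>v y = \<sigma> \<cdot>\<^sub>v x" "transpose_mat M *\<^sub>v x = \<sigma> \<cdot>\<^sub>v y"
proof -
  let ?T = "transpose_mat M"
  have T: "?T \<in> carrier_mat n m" using M by simp
  have TM: "?T * M \<in> carrier_mat n n" using T M by simp
  have "transpose_mat (?T * M) = ?T * M" using transpose_mult[OF T M] by simp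
  then obtain v l where v: "v \<in> carrier_vec n" "v \<noteq> 0\<^sub>v n" "(?T * M) *\<^sub>v v = l \<cdot>\<^sub>v v"
    using real_symmetric_eigenvector[OF TM _ \<open>n > 0\<close>] by blast
  obtain c where c: "c > 0" "(c \<cdot>\<^sub>v v) \<bullet> (c \<cdot>\<^sub>v v) = 1"
    using real_vec_normalize[OF v(1,2)] by metis
  define y where "y = c \<cdot>\<^sub>v v"
  have y: "y \<in> carrier_vec n" "y \<bullet> y = 1" using c v by (auto simp: y_def)
  have Gy: "?T *\<^sub>v (M *\<^sub>v y) = l \<cdot>\<^sub>v y"
  proof -
    have "?T *\<^sub>v (M *\<^sub>v y) = (?T * M) *\<^sub>v y" using T M y by simp
    also have "\<dots> = c \<cdot>\<^sub>v (l \<cdot>\<^sub>v v)" unfolding y_def using mult_mat_vec[OF TM v(1)] v(3) by simp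
    also have "\<dots> = l \<cdot>\<^sub>v y" unfolding y_def by (simp add: smult_smult_assoc mult.commute)
    finally show ?thesis .
  qed
  have My: "M *\<^sub>v y \<in> carrier_vec m" using M y by simp
  show ?thesis
  proof (cases "M *\<^sub>v y = 0\<^sub>v m")
    case True
    have "y \<noteq> 0\<^sub>v n" using y by auto
    then obtain u where u: "u \<in> carrier_vec m" "u \<noteq> 0\<^sub>v m" "?T *\<^sub>v u = 0\<^sub>v n"
      using kernel_transpose_nontrivial[OF M \<open>n \<le> m\<close> y(1) _ True] by blast
    obtain b where b: "b > 0" "(b \<cdot>\<^sub>v u) \<bullet> (b \<cdot>\<^sub>v u) = 1"
      using real_vec_normalize[OF u(1,2)] by metis
    show ?thesis
    proof (rule that[of "b \<cdot>\<^sub>v u" y 0])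
      show "?T *\<^sub>v (b \<cdot>\<^sub>v u) = 0 \<cdot>\<^sub>v y"
        using mult_mat_vec[OF T u(1)] u(3) y by auto
    qed (use b u y True in auto)
  next
    case False
    obtain b where b: "b > 0" "(b \<cdot>\<^sub>v (M *\<^sub>v y)) \<bullet> (b \<cdot>\<^sub>v (M *\<^sub>v y)) = 1"
        "b\<^sup>2 * ((M *\<^sub>v y) \<bullet> (M *\<^sub>v y)) = 1"
      using real_vec_normalize[OF My False] by metis
    have "(M *\<^sub>v y) \<bullet> (M *\<^sub>v y) = (?T *\<^sub>v (M *\<^sub>v y)) \<bullet> y"
      using transpose_vec_mult_scalar[OF M y(1) My] by simp
    also have "\<dots> = l" unfolding Gy using y by simp
    finally have bl: "b\<^sup>2 * l = 1" using b by simp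
    show ?thesis
    \<comment> \<open>\<open>1 / b\<close> is the length of M y, and by \<open>bl\<close> the
      eigenvalue \<open>l\<close> of M^T M is its square.\<close>
    proof (rule that[of "b \<cdot>\<^sub>v (M *\<^sub>v y)" y "1 / b"])
      show "M *\<^sub>v y = 1 / b \<cdot>\<^sub>v (b \<cdot>\<^sub>v (M *\<^sub>v y))" using b by (simp add: smult_smult_assoc)
      have "?T *\<^sub>v (b \<cdot>\<^sub>v (M *\<^sub>v y)) = b \<cdot>\<^sub>v (l \<cdot>\<^sub>v y)" using mult_mat_vec[OF T My] Gy by simp
      also have "\<dots> = (b * l) \<cdot>\<^sub>v y" by (simp add: smult_smult_assoc)
      also have "b * l = 1 / b" using bl b(1) by (simp add: power2_eq_square field_simps)
      finally show "?T *\<^sub>v (b \<cdot>\<^sub>v (M *\<^sub>v y)) = 1 / b \<cdot>\<^sub>v y" .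
    qed (use b y My in auto)
  qed
qed

section \<open>Splitting off singular values one at a time\<close>

definition bordered_mat :: "real mat \<Rightarrow> real mat" where
  "bordered_mat X = four_block_mat (1\<^sub>m 1) (0\<^sub>m 1 (dim_col X)) (0\<^sub>m (dim_row X) 1) X"

lemma bordered_mat_carrier: "X \<in> carrier_mat n k \<Longrightarrow> bordered_mat X \<in> carrier_mat (Suc n) (Suc k)"
  unfolding bordered_mat_def carrier_mat_def by simp

lemma transpose_bordered_mat: "transpose_mat (bordered_mat X) = bordered_mat (transpose_mat X)"
  unfolding bordered_mat_def
  using transpose_four_block_mat[OF one_carrier_mat zero_carrier_mat zero_carrier_mat
      carrier_matI[OF refl refl], of 1 X] by simp

lemma orthogonal_mat_bordered:
  assumes "orthogonal_mat n U"
  shows "orthogonal_mat (Suc n) (bordered_mat U)"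
proof -
  note u = orthogonal_matD[OF assms]
  have m: "bordered_mat X * bordered_mat Y = bordered_mat (X * Y)"
    if "X \<in> carrier_mat n n" "Y \<in> carrier_mat n n" for X Y
    using that unfolding bordered_mat_def
    by (subst mult_four_block_mat[of _ 1 1 _ n _ n _ _ 1 _ n]) auto
  have one: "bordered_mat (1\<^sub>m n) = 1\<^sub>m (Suc n)"
    unfolding bordered_mat_def by (rule eq_matI) auto
  show ?thesis
    unfolding orthogonal_mat_def transpose_bordered_mat
    using u by (simp add: m one bordered_mat_carrier)
qed

definition diag_rect_mat :: "nat \<Rightarrow> nat \<Rightarrow> (nat \<Rightarrow> real) \<Rightarrow> real mat" where
  "diag_rect_mat m n s = mat m n (\<lambda>(i,j). if i = j then s i else 0)"

lemma diag_rect_mat_carrier: "diag_rect_mat m n s \<in> carrier_mat m n"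
  by (simp add: diag_rect_mat_def)

text \<open>Orthogonal changes of basis move a singular pair to the first unit vectors. Row 0 and
  column 0 then vanish off the corner, and the remaining block has one row and one column less;
  hence the induction on \<open>n\<close> with \<open>m\<close> arbitrary.\<close>

theorem real_svd:
  fixes M :: "real mat"
  assumes "M \<in> carrier_mat m n" "n \<le> m"
  shows "\<exists>U V s. orthogonal_mat m U \<and> orthogonal_mat n V \<and>
    M = U * diag_rect_mat m n s * transpose_mat V"
  using assms
proof (induction n arbitrary: m M)
  case 0
  have "M = 1\<^sub>m m * diag_rect_mat m 0 s * transpose_mat (1\<^sub>m 0)" for s
    using 0 by (intro eq_matI) (auto simp: diag_rect_mat_def)
  then show ?case using orthogonal_mat_one by blast
next
  case (Suc n m0)
  then obtain m where m0: "m0 = Suc m" and nm: "n \<le> m" by (cases m0) auto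
  have M: "M \<in> carrier_mat (Suc m) (Suc n)" using Suc.prems m0 by simp
  obtain x y \<sigma> where x: "x \<in> carrier_vec (Suc m)" "x \<bullet> x = 1"
    and y: "y \<in> carrier_vec (Suc n)" "y \<bullet> y = 1"
    and xy: "M *\<^sub>v y = \<sigma> \<cdot>\<^sub>v x" "transpose_mat M *\<^sub>v x = \<sigma> \<cdot>\<^sub>v y"
    by (rule singular_pair[OF M]) (use nm in auto)
  let ?em = "unit_vec (Suc m) 0 :: real vec" and ?en = "unit_vec (Suc n) 0 :: real vec"
  obtain U1 where U1: "orthogonal_mat (Suc m) U1" "U1 *\<^sub>v ?em = x"
    using orthogonal_mat_householder[OF x] by blast
  obtain V1 where V1: "orthogonal_mat (Suc n) V1" "V1 *\<^sub>v ?en = y"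
    using orthogonal_mat_householder[OF y] by blast
  note u1 = orthogonal_matD[OF U1(1)] and v1 = orthogonal_matD[OF V1(1)]
  let ?U1T = "transpose_mat U1" and ?V1T = "transpose_mat V1"
  define D where "D = ?U1T * (M * V1)"
  have D: "D \<in> carrier_mat (Suc m) (Suc n)" using u1(2) M v1(1) unfolding D_def by simp
  have MV: "M * V1 \<in> carrier_mat (Suc m) (Suc n)" using M v1 by simp
  have ux: "?U1T *\<^sub>v x = ?em" 
    unfolding U1(2)[symmetric] using assoc_mult_mat_vec[OF u1(2,1), of ?em] u1(3) by simp
  have vy: "?V1T *\<^sub>v y = ?en" 
    unfolding V1(2)[symmetric] using assoc_mult_mat_vec[OF v1(2,1), of ?en] v1(3) by simp
  have De: "D *\<^sub>v ?en = \<sigma> \<cdot>\<^sub>v ?em"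
  proof -
    have "D *\<^sub>v ?en = ?U1T *\<^sub>v (M *\<^sub>v (V1 *\<^sub>v ?en))"
      unfolding D_def using assoc_mult_mat_vec[OF u1(2) MV] assoc_mult_mat_vec[OF M v1(1)] by simp
    also have "\<dots> = \<sigma> \<cdot>\<^sub>v ?em" unfolding V1(2) xy(1) using mult_mat_vec[OF u1(2) x(1)] ux by simp
    finally show ?thesis .
  qed
  have DTe: "transpose_mat D *\<^sub>v ?em = \<sigma> \<cdot>\<^sub>v ?en"
  proof -
    have MT: "transpose_mat M \<in> carrier_mat (Suc n) (Suc m)" using M by simp
    have "transpose_mat D = ?V1T * (transpose_mat M * U1)"
      unfolding D_def using transpose_mult[OF u1(2) MV] transpose_mult[OF M v1(1)]
        assoc_mult_mat[OF v1(2) MT u1(1)] by simp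
    then have "transpose_mat D *\<^sub>v ?em = ?V1T *\<^sub>v (transpose_mat M *\<^sub>v (U1 *\<^sub>v ?em))"
      using assoc_mult_mat_vec[OF v1(2) mult_carrier_mat[OF MT u1(1)], of ?em]
        assoc_mult_mat_vec[OF MT u1(1), of ?em] by simp
    also have "\<dots> = \<sigma> \<cdot>\<^sub>v ?en" unfolding U1(2) xy(2) using mult_mat_vec[OF v1(2) y(1)] vy by simp
    finally show ?thesis .
  qed
  \<comment> \<open>The equation for M y clears the first column, the one for M^T x the first row;
    both are required for a block diagonal \<open>D\<close>.\<close>
  have D0: "D $$ (i, 0) = (if i = 0 then \<sigma> else 0)" if "i < Suc m" for i
    using arg_cong[OF De, of "\<lambda>v. v $ i"] that D by simp
  have D1: "D $$ (0, j) = (if j = 0 then \<sigma> else 0)" if "j < Suc n" for j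
    using arg_cong[OF DTe, of "\<lambda>v. v $ j"] that D by simp
  define M2 where "M2 = mat m n (\<lambda>(i,j). D $$ (Suc i, Suc j))"
  obtain U2 V2 s where U2: "orthogonal_mat m U2" and V2: "orthogonal_mat n V2"
    and M2: "M2 = U2 * diag_rect_mat m n s * transpose_mat V2"
    using Suc.IH[of M2 m] nm by (auto simp: M2_def)
  note u2 = orthogonal_matD[OF U2] and v2 = orthogonal_matD[OF V2]
  let ?a = "mat 1 1 (\<lambda>_. \<sigma>)"
  \<comment> \<open>\<open>case_nat \<sigma> s\<close> puts the new singular value in front of those
    of the smaller block.\<close>
  let ?S = "diag_rect_mat (Suc m) (Suc n) (case_nat \<sigma> s)"
  have Sblk: "?S = four_block_mat ?a (0\<^sub>m 1 n) (0\<^sub>m m 1) (diag_rect_mat m n s)"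
    by (rule eq_matI) (auto simp: diag_rect_mat_def split: nat.splits)
  have US: "bordered_mat U2 * ?S
      = four_block_mat ?a (0\<^sub>m 1 n) (0\<^sub>m m 1) (U2 * diag_rect_mat m n s)"
    unfolding Sblk bordered_mat_def using u2
    by (subst mult_four_block_mat[of _ 1 1 _ m _ m _ _ 1 _ n]) (auto simp: diag_rect_mat_def)
  have "bordered_mat U2 * ?S * transpose_mat (bordered_mat V2)
      = four_block_mat ?a (0\<^sub>m 1 n) (0\<^sub>m m 1) M2"
    unfolding US transpose_bordered_mat M2 unfolding bordered_mat_def using u2 v2
    by (subst mult_four_block_mat[of _ 1 1 _ n _ m _ _ 1 _ n]) (auto simp: diag_rect_mat_def)
  also have "\<dots> = D"
    using D by (intro eq_matI) (auto simp: M2_def D0 D1)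
  finally have Dfac: "D = bordered_mat U2 * ?S * transpose_mat (bordered_mat V2)" ..
  note bu = bordered_mat_carrier[OF u2(1)] and bv = bordered_mat_carrier[OF v2(1)]
  have S: "?S \<in> carrier_mat (Suc m) (Suc n)" by (rule diag_rect_mat_carrier)
  have bvt: "transpose_mat (bordered_mat V2) \<in> carrier_mat (Suc n) (Suc n)" using bv by simp
  have "M = U1 * D * ?V1T"
  proof -
    have "U1 * D = (U1 * ?U1T) * (M * V1)"
      unfolding D_def using assoc_mult_mat[OF u1(1,2) MV] by simp
    also have "\<dots> = M * V1" using u1(4) left_mult_one_mat[OF MV] by simp
    finally have "U1 * D * ?V1T = M * (V1 * ?V1T)" using assoc_mult_mat[OF M v1(1,2)] by simp
    then show ?thesis using v1(4) right_mult_one_mat[OF M] by simp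
  qed
  also have "\<dots> = (U1 * bordered_mat U2) * ?S * transpose_mat (V1 * bordered_mat V2)"
  proof -
    let ?W = "transpose_mat (bordered_mat V2)"
    have "U1 * (bordered_mat U2 * ?S * ?W) * ?V1T = (U1 * (bordered_mat U2 * ?S)) * ?W * ?V1T"
      by (simp only: assoc_mult_mat[OF u1(1) mult_carrier_mat[OF bu S] bvt])
    also have "\<dots> = (U1 * bordered_mat U2 * ?S) * ?W * ?V1T"
      by (simp only: assoc_mult_mat[OF u1(1) bu S])
    also have "\<dots> = (U1 * bordered_mat U2 * ?S) * (?W * ?V1T)"
      by (rule assoc_mult_mat[OF mult_carrier_mat[OF mult_carrier_mat[OF u1(1) bu] S] bvt v1(2)])
    finally show ?thesis unfolding Dfac transpose_mult[OF v1(1) bv] .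
  qed
  finally show ?case
    unfolding m0
    using orthogonal_mat_mult[OF U1(1) orthogonal_mat_bordered[OF U2]]
      orthogonal_mat_mult[OF V1(1) orthogonal_mat_bordered[OF V2]] by blast
qed

section \<open>Normal form of the bipartite coupling matrix\<close>

lemma sum_lessThan_double:
  fixes F :: "nat \<Rightarrow> 'a::comm_monoid_add"
  shows "(\<Sum>r<2 * n. F r) = (\<Sum>k<n. F (2 * k) + F (2 * k + 1))"
  by (induction n) (simp_all add: add.assoc)

lemma orthogonal_mat_sum:
  assumes "orthogonal_mat n U" "i < n" "j < n"
  shows "(\<Sum>k<n. U $$ (k,i) * U $$ (k,j)) = (if i = j then 1 else 0)"
    and "(\<Sum>k<n. U $$ (i,k) * U $$ (j,k)) = (if i = j then 1 else 0)"
proof -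
  note u = orthogonal_matD[OF assms(1)]
  have "(transpose_mat U * U) $$ (i,j) = (\<Sum>k<n. U $$ (k,i) * U $$ (k,j))"
    using assms u(1) by (simp add: scalar_prod_def atLeast0LessThan)
  then show "(\<Sum>k<n. U $$ (k,i) * U $$ (k,j)) = (if i = j then 1 else 0)"
    using assms u(3) by simp
  have "(U * transpose_mat U) $$ (i,j) = (\<Sum>k<n. U $$ (i,k) * U $$ (j,k))"
    using assms u(1) by (simp add: scalar_prod_def atLeast0LessThan)
  then show "(\<Sum>k<n. U $$ (i,k) * U $$ (j,k)) = (if i = j then 1 else 0)"
    using assms u(4) by simp
qed

text \<open>Only the first \<open>n\<close> columns of \<open>U\<close> enter the sum. The other
  \<open>m - n\<close> are left singular vectors without a partner; they become the Majorana
  operators that drop out of the Hamiltonian.\<close>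

lemma real_svd_entries:
  fixes M :: "nat \<Rightarrow> nat \<Rightarrow> real"
  assumes "n \<le> m"
  obtains U V s where "orthogonal_mat m U" "orthogonal_mat n V"
    "\<And>i j. i < m \<Longrightarrow> j < n \<Longrightarrow> M i j = (\<Sum>k<n. s k * (U $$ (i,k) * V $$ (j,k)))"
proof -
  obtain U V s where U: "orthogonal_mat m U" and V: "orthogonal_mat n V"
    and eq: "mat m n (\<lambda>(i,j). M i j) = U * diag_rect_mat m n s * transpose_mat V"
    using real_svd[OF mat_carrier assms] by blast
  note u = orthogonal_matD(1)[OF U] and v = orthogonal_matD(1)[OF V]
  have US: "U * diag_rect_mat m n s = mat m n (\<lambda>(i,k). U $$ (i,k) * s k)"
  proof (rule eq_matI)
    fix i j assume "i < dim_row (mat m n (\<lambda>(i,k). U $$ (i,k) * s k))"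
      "j < dim_col (mat m n (\<lambda>(i,k). U $$ (i,k) * s k))"
    then have ij: "i < m" "j < n" "j < m" using assms by auto
    have "(U * diag_rect_mat m n s) $$ (i,j) = (\<Sum>k<m. U $$ (i,k) * (if k = j then s k else 0))"
      using ij u by (simp add: diag_rect_mat_def scalar_prod_def atLeast0LessThan)
    also have "\<dots> = (\<Sum>k<m. if k = j then U $$ (i,k) * s k else 0)"
      by (intro sum.cong) auto
    finally show "(U * diag_rect_mat m n s) $$ (i,j) = mat m n (\<lambda>(i,k). U $$ (i,k) * s k) $$ (i,j)"
      using ij by simp
  qed (use u in \<open>auto simp: diag_rect_mat_def\<close>)
  have "M i j = (\<Sum>k<n. s k * (U $$ (i,k) * V $$ (j,k)))" if ij: "i < m" "j < n" for i j
  proof -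
    have "M i j = mat m n (\<lambda>(i,j). M i j) $$ (i,j)" using ij by simp
    also have "\<dots> = (\<Sum>k<n. s k * (U $$ (i,k) * V $$ (j,k)))"
      unfolding eq US using ij v
      by (auto simp: scalar_prod_def atLeast0LessThan mult_ac intro!: sum.cong)
    finally show ?thesis .
  qed
  then show ?thesis using that U V by blast
qed

text \<open>The rows of \<open>Q\<close> are the coefficient vectors of new Majorana operators, paired as
  \<open>(2k, 2k+1)\<close>; each pair is a pair of singular vectors of the block \<open>h\<^bsub>AB\<^esub>\<close>,
  and the surplus of \<open>A\<close> is paired among itself with \<open>e k = 0\<close>.\<close>

lemma bipartite_normal_form:
  fixes h :: "nat \<Rightarrow> nat \<Rightarrow> real"
  assumes antisym: "\<forall>\<alpha><2*N. \<forall>\<beta><2*N. h \<alpha> \<beta> = - h \<beta> \<alpha>"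
    and part: "A \<union> B = {..<2*N}" "A \<inter> B = {}"
    and AB: "card A \<ge> card B"
    and bip: "\<forall>\<alpha><2*N. \<forall>\<beta><2*N.
                 \<not> ((\<alpha> \<in> A \<and> \<beta> \<in> B) \<or> (\<alpha> \<in> B \<and> \<beta> \<in> A)) \<longrightarrow> h \<alpha> \<beta> = 0"
  obtains Q :: "nat \<Rightarrow> nat \<Rightarrow> real" and e :: "nat \<Rightarrow> real" where
    "\<And>k l. k < 2*N \<Longrightarrow> l < 2*N \<Longrightarrow> (\<Sum>j<2*N. Q k j * Q l j) = (if k = l then 1 else 0)"
    "\<And>i j. i < 2*N \<Longrightarrow> j < 2*N \<Longrightarrow> (\<Sum>k<2*N. Q k i * Q k j) = (if i = j then 1 else 0)"
    "\<And>k b. k < N \<Longrightarrow> b \<in> B \<Longrightarrow> Q (2*k) b = 0"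
    "\<And>a b. a < 2*N \<Longrightarrow> b < 2*N \<Longrightarrow>
       h a b = (\<Sum>k<N. e k * (Q (2*k) a * Q (2*k+1) b - Q (2*k+1) a * Q (2*k) b))"
proof -
  define m n where "m = card A" and "n = card B"
  have fin: "finite A" "finite B" using part(1) by (metis finite_Un finite_lessThan)+
  have mn: "m + n = 2 * N" using card_Un_disjoint[OF fin part(2)] part(1)
    by (simp add: m_def n_def)
  have nm: "n \<le> m" using AB by (simp add: m_def n_def)
  have nN: "n \<le> N" using mn nm by simp
  obtain f where f: "bij_betw f A {..<m}"
    using ex_bij_betw_finite_nat[OF fin(1)] by (auto simp: m_def atLeast0LessThan)
  obtain g where g: "bij_betw g B {..<n}"
    using ex_bij_betw_finite_nat[OF fin(2)] by (auto simp: n_def atLeast0LessThan)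
  have fl: "f a < m" if "a \<in> A" for a using f that by (auto simp: bij_betw_def)
  have gl: "g b < n" if "b \<in> B" for b using g that by (auto simp: bij_betw_def)
  have finj: "f a = f b \<longleftrightarrow> a = b" if "a \<in> A" "b \<in> A" for a b
    using f that by (auto simp: bij_betw_def inj_on_def)
  have ginj: "g a = g b \<longleftrightarrow> a = b" if "a \<in> B" "b \<in> B" for a b
    using g that by (auto simp: bij_betw_def inj_on_def)
  obtain U V s where U: "orthogonal_mat m U" and V: "orthogonal_mat n V"
    and sv: "\<And>i j. i < m \<Longrightarrow> j < n \<Longrightarrow>
      h (inv_into A f i) (inv_into B g j) = (\<Sum>k<n. s k * (U $$ (i,k) * V $$ (j,k)))"
    using real_svd_entries[OF nm, of "\<lambda>i j. h (inv_into A f i) (inv_into B g j)"] by metis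
  define P where "P k a = (if a \<in> A then U $$ (f a, k) else 0)" for k a
  define R where "R k b = (if b \<in> B then V $$ (g b, k) else 0)" for k b
  \<comment> \<open>The first 2n rows alternate between left and right singular vectors. From r = 2n
    on, \<open>r - n\<close> runs through n, ..., m - 1, the unmatched left ones; there are 2N rows
    because m + n = 2N.\<close>
  define Q where "Q r = (if r < 2 * n then if even r then P (r div 2) else R (r div 2)
    else P (r - n))" for r
  define e where "e k = (if k < n then s k else 0)" for k
  have PP: "(\<Sum>j<2*N. P k j * P l j) = (if k = l then 1 else 0)" if "k < m" "l < m" for k l
  proof -
    have "(\<Sum>j<2*N. P k j * P l j) = (\<Sum>j\<in>A. U $$ (f j, k) * U $$ (f j, l))"
      unfolding P_def using part(1) by (intro sum.mono_neutral_cong_right) auto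
    also have "\<dots> = (\<Sum>i<m. U $$ (i, k) * U $$ (i, l))"
      by (rule sum.reindex_bij_betw[OF f])
    finally show ?thesis using orthogonal_mat_sum(1)[OF U that] by simp
  qed
  have RR: "(\<Sum>j<2*N. R k j * R l j) = (if k = l then 1 else 0)" if "k < n" "l < n" for k l
  proof -
    have "(\<Sum>j<2*N. R k j * R l j) = (\<Sum>j\<in>B. V $$ (g j, k) * V $$ (g j, l))"
      unfolding R_def using part(1) by (intro sum.mono_neutral_cong_right) auto
    also have "\<dots> = (\<Sum>i<n. V $$ (i, k) * V $$ (i, l))"
      by (rule sum.reindex_bij_betw[OF g])
    finally show ?thesis using orthogonal_mat_sum(1)[OF V that] by simp
  qed
  have PR: "P k j * R l j = 0" "R l j * P k j = 0" for k l j
    using part(2) by (auto simp: P_def R_def)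
  have rows: "(\<Sum>j<2*N. Q k j * Q l j) = (if k = l then 1 else 0)"
    if "k < 2*N" "l < 2*N" for k l
  proof -
    have idx: "k div 2 < n" if "k < 2 * n" for k using that by simp
    have par: "k div 2 = l div 2 \<longleftrightarrow> k = l" if "even k \<longleftrightarrow> even l" for k l :: nat
      using that by (metis even_two_times_div_two odd_two_times_div_two_succ)
    show ?thesis
      using that mn nm
      by (cases "k < 2 * n"; cases "l < 2 * n"; cases "even k"; cases "even l")
        (auto simp: Q_def PP RR PR par)
  qed
  have cols: "(\<Sum>r<2*N. Q r i * Q r j) = (if i = j then 1 else 0)"
    if ij: "i < 2*N" "j < 2*N" for i j
  proof -
    have "(\<Sum>r<2*N. Q r i * Q r j)
        = (\<Sum>r<2*n. Q r i * Q r j) + (\<Sum>r\<in>{n + n..<m + n}. Q r i * Q r j)"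
      using mn nN by (subst sum.union_disjoint[symmetric]) (auto intro!: sum.cong)
    also have "(\<Sum>r<2*n. Q r i * Q r j) = (\<Sum>k<n. P k i * P k j) + (\<Sum>k<n. R k i * R k j)"
      unfolding sum_lessThan_double by (simp add: Q_def sum.distrib)
    \<comment> \<open>A shift of the index by \<open>n\<close> turns these rows into the columns n,
      ..., m - 1 of \<open>U\<close>, which complete the partial sum over k < n to a full
      orthogonality relation.\<close>
    also have "(\<Sum>r\<in>{n + n..<m + n}. Q r i * Q r j) = (\<Sum>k\<in>{n..<m}. P k i * P k j)"
      unfolding sum.shift_bounds_nat_ivl by (simp add: Q_def)
    also have "(\<Sum>k<n. P k i * P k j) + (\<Sum>k<n. R k i * R k j) + (\<Sum>k\<in>{n..<m}. P k i * P k j)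
        = (\<Sum>k<m. P k i * P k j) + (\<Sum>k<n. R k i * R k j)"
      using sum.atLeastLessThan_concat[of 0 n m "\<lambda>k. P k i * P k j"] nm
      by (simp add: atLeast0LessThan ac_simps)
    also have "(\<Sum>k<m. P k i * P k j) = (if i = j \<and> i \<in> A then 1 else 0)"
      using orthogonal_mat_sum(2)[OF U fl fl, of i j] finj[of i j]
      by (cases "i \<in> A"; cases "j \<in> A") (auto simp: P_def)
    also have "(\<Sum>k<n. R k i * R k j) = (if i = j \<and> i \<in> B then 1 else 0)"
      using orthogonal_mat_sum(2)[OF V gl gl, of i j] ginj[of i j]
      by (cases "i \<in> B"; cases "j \<in> B") (auto simp: R_def)
    also have "(if i = j \<and> i \<in> A then 1 else 0) + (if i = j \<and> i \<in> B then 1 else 0 :: real)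
        = (if i = j then 1 else 0)"
      using ij part by auto
    finally show ?thesis .
  qed
  \<comment> \<open>An even row is a left singular vector, matched or not, and these are supported
    on A. This is the source of the vanishing correlations inside B.\<close>
  have QB: "Q (2*k) b = 0" if "k < N" "b \<in> B" for k b
    using that part(2) by (auto simp: Q_def P_def)
  have hform: "h a b = (\<Sum>k<N. e k * (Q (2*k) a * Q (2*k+1) b - Q (2*k+1) a * Q (2*k) b))"
    if ab: "a < 2*N" "b < 2*N" for a b
  proof -
    have hAB: "h a b = (\<Sum>k<n. s k * (P k a * R k b))" if "a \<in> A" "b \<in> B" for a b
      using sv[OF fl gl, of a b] that f g
      by (simp add: P_def R_def bij_betw_inv_into_left)
    have "(\<Sum>k<N. e k * (Q (2*k) a * Q (2*k+1) b - Q (2*k+1) a * Q (2*k) b))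
        = (\<Sum>k<n. s k * (P k a * R k b - R k a * P k b))"
      using nN by (intro sum.mono_neutral_cong_right) (auto simp: e_def Q_def)
    also have "\<dots> = (\<Sum>k<n. s k * (P k a * R k b)) - (\<Sum>k<n. s k * (P k b * R k a))"
      by (simp add: sum_subtractf[symmetric] algebra_simps)
    also have "\<dots> = h a b"
    proof -
      have ab': "a \<in> A \<or> a \<in> B" "b \<in> A \<or> b \<in> B" using ab part(1) by auto
      have PB: "P k x = 0" if "x \<in> B" for k x using that part(2) by (auto simp: P_def)
      have RA: "R k x = 0" if "x \<in> A" for k x using that part(2) by (auto simp: R_def)
      consider "a \<in> A" "b \<in> B" | "a \<in> B" "b \<in> A" | "a \<in> A" "b \<in> A" | "a \<in> B" "b \<in> B"
        using ab' by blast
      then show ?thesis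
      proof cases
        case 1 then show ?thesis using hAB[of a b] by (simp add: RA)
      next
        case 2
        have "h a b = - h b a" using antisym ab by blast
        then show ?thesis using hAB[of b a] 2 by (simp add: RA)
      next
        case 3
        then have "h a b = 0" using bip ab part(2) by blast
        then show ?thesis using 3 by (simp add: RA)
      next
        case 4
        then have "h a b = 0" using bip ab part(2) by blast
        then show ?thesis using 4 by (simp add: PB)
      qed
    qed
    finally show ?thesis ..
  qed
  show ?thesis using that[of Q e] rows cols QB hform by blast
qed

section \<open>Majorana operators\<close>

lemma adjoint_inner:
  fixes M M' :: "complex mat"
  assumes "M \<in> carrier_mat n n" "M' \<in> carrier_mat n n" "v \<in> carrier_vec n" "w \<in> carrier_vec n"
    and adj: "\<And>r c. r < n \<Longrightarrow> c < n \<Longrightarrow> M' $$ (r,c) = cnj (M $$ (c,r))"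
  shows "(M *\<^sub>v v) \<bullet>c w = v \<bullet>c (M' *\<^sub>v w)"
proof -
  have "(M *\<^sub>v v) \<bullet>c w = (\<Sum>r<n. \<Sum>c<n. M $$ (r,c) * v $ c * cnj (w $ r))"
    using assms by (simp add: scalar_prod_def atLeast0LessThan sum_distrib_right)
  also have "\<dots> = (\<Sum>c<n. \<Sum>r<n. M $$ (r,c) * v $ c * cnj (w $ r))"
    by (rule sum.swap)
  also have "\<dots> = v \<bullet>c (M' *\<^sub>v w)"
    using assms by (simp add: scalar_prod_def atLeast0LessThan sum_distrib_left mult_ac)
  finally show ?thesis .
qed

text \<open>Passage to \<open>\<bullet>c\<close>, which is linear in its left argument; operators
  can then be moved across by their adjoints.\<close>

lemma expect_inner:
  assumes "X \<in> carrier_mat n n" "\<psi> \<in> carrier_vec n"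
  shows "expect \<psi> X = (X *\<^sub>v \<psi>) \<bullet>c \<psi>"
  using assms unfolding expect_def by (intro comm_scalar_prod[of _ n]) auto

locale majorana =
  fixes N :: nat and \<omega> :: "nat \<Rightarrow> complex mat"
  assumes majorana: "majorana_family N \<omega>"
begin

abbreviation "d \<equiv> fock_dim N"

lemma omega_carrier [simp]: "j < 2*N \<Longrightarrow> \<omega> j \<in> carrier_mat d d"
  using majorana by (simp add: majorana_family_def)

lemma omega_dim [simp]: "j < 2*N \<Longrightarrow> dim_row (\<omega> j) = d" "j < 2*N \<Longrightarrow> dim_col (\<omega> j) = d"
  by (rule carrier_matD[OF omega_carrier], assumption)+

lemma omega_hermitian:
  "j < 2*N \<Longrightarrow> r < d \<Longrightarrow> c < d \<Longrightarrow> \<omega> j $$ (r,c) = cnj (\<omega> j $$ (c,r))"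
  using majorana unfolding majorana_family_def by blast

lemma omega_anticommutator:
  "j < 2*N \<Longrightarrow> k < 2*N \<Longrightarrow>
   \<omega> j * \<omega> k + \<omega> k * \<omega> j = (if j = k then 2 else 0) \<cdot>\<^sub>m 1\<^sub>m d"
  using majorana by (simp add: majorana_family_def)

lemma omega_anticommutator_vec:
  assumes "j < 2*N" "k < 2*N" and v: "v \<in> carrier_vec d" and "r < d"
  shows "(\<omega> j *\<^sub>v (\<omega> k *\<^sub>v v)) $ r + (\<omega> k *\<^sub>v (\<omega> j *\<^sub>v v)) $ r = (if j = k then 2 else 0) * v $ r"
proof -
  have c: "\<omega> j \<in> carrier_mat d d" "\<omega> k \<in> carrier_mat d d" using assms by auto
  have "\<omega> j *\<^sub>v (\<omega> k *\<^sub>v v) + \<omega> k *\<^sub>v (\<omega> j *\<^sub>v v) = (\<omega> j * \<omega> k + \<omega> k * \<omega> j) *\<^sub>v v"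
    using assoc_mult_mat_vec[OF c v] assoc_mult_mat_vec[OF c(2,1) v]
      add_mult_distrib_mat_vec[OF mult_carrier_mat[OF c] mult_carrier_mat[OF c(2,1)] v] by simp
  also have "\<dots> = (if j = k then 2 else 0) \<cdot>\<^sub>v v"
    unfolding omega_anticommutator[OF assms(1,2)] using v
    by (intro eq_vecI) auto
  finally have "(\<omega> j *\<^sub>v (\<omega> k *\<^sub>v v) + \<omega> k *\<^sub>v (\<omega> j *\<^sub>v v)) $ r = ((if j = k then 2 else 0) \<cdot>\<^sub>v v) $ r"
    by simp
  then show ?thesis using assms by (simp del: index_mult_mat_vec)
qed

text \<open>The coefficients are complex so that one construction covers both the rotated Majorana
  operators (real coefficients) and the annihilators of a Gaussian state.\<close>

definition lincomb :: "(nat \<Rightarrow> complex) \<Rightarrow> complex mat" where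
  "lincomb x = mat d d (\<lambda>(r,c). \<Sum>j<2*N. x j * \<omega> j $$ (r,c))"

lemma lincomb_carrier [simp]: "lincomb x \<in> carrier_mat d d"
  by (simp add: lincomb_def)

lemma lincomb_dim [simp]: "dim_row (lincomb x) = d" "dim_col (lincomb x) = d"
  by (simp_all add: lincomb_def)

lemma lincomb_vec_carrier [simp]: "v \<in> carrier_vec d \<Longrightarrow> lincomb x *\<^sub>v v \<in> carrier_vec d"
  by (rule mult_mat_vec_carrier[OF lincomb_carrier])

lemma omega_vec_carrier [simp]: "a < 2*N \<Longrightarrow> v \<in> carrier_vec d \<Longrightarrow> \<omega> a *\<^sub>v v \<in> carrier_vec d"
  by (rule mult_mat_vec_carrier[OF omega_carrier])

lemma lincomb_index:
  assumes "v \<in> carrier_vec d" "r < d"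
  shows "(lincomb x *\<^sub>v v) $ r = (\<Sum>j<2*N. x j * (\<omega> j *\<^sub>v v) $ r)"
proof -
  have "(lincomb x *\<^sub>v v) $ r = (\<Sum>c<d. \<Sum>j<2*N. x j * (\<omega> j $$ (r,c) * v $ c))"
    using assms by (simp add: lincomb_def scalar_prod_def atLeast0LessThan sum_distrib_right mult.assoc)
  also have "\<dots> = (\<Sum>j<2*N. \<Sum>c<d. x j * (\<omega> j $$ (r,c) * v $ c))" by (rule sum.swap)
  also have "\<dots> = (\<Sum>j<2*N. x j * (\<omega> j *\<^sub>v v) $ r)"
    using assms by (intro sum.cong) (auto simp: scalar_prod_def atLeast0LessThan sum_distrib_left)
  finally show ?thesis .
qed

lemma mult_lincomb_index:
  assumes "v \<in> carrier_vec d" "r < d" "A \<in> carrier_mat d d"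
  shows "(A *\<^sub>v (lincomb x *\<^sub>v v)) $ r = (\<Sum>j<2*N. x j * (A *\<^sub>v (\<omega> j *\<^sub>v v)) $ r)"
proof -
  have "(A *\<^sub>v (lincomb x *\<^sub>v v)) $ r = (\<Sum>c<d. A $$ (r,c) * (lincomb x *\<^sub>v v) $ c)"
  proof -
    have "(A *\<^sub>v (lincomb x *\<^sub>v v)) $ r = row A r \<bullet> (lincomb x *\<^sub>v v)" using assms by simp
    then show ?thesis
      using assms by (simp add: scalar_prod_def[of "row A r"] atLeast0LessThan del: index_mult_mat_vec)
  qed
  also have "\<dots> = (\<Sum>c<d. \<Sum>j<2*N. x j * (A $$ (r,c) * (\<omega> j *\<^sub>v v) $ c))"
    using assms by (simp add: lincomb_index sum_distrib_left mult_ac del: index_mult_mat_vec)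
  also have "\<dots> = (\<Sum>j<2*N. \<Sum>c<d. x j * (A $$ (r,c) * (\<omega> j *\<^sub>v v) $ c))" by (rule sum.swap)
  also have "\<dots> = (\<Sum>j<2*N. x j * (A *\<^sub>v (\<omega> j *\<^sub>v v)) $ r)"
    using assms by (intro sum.cong) (auto simp: scalar_prod_def[of "row A r"] atLeast0LessThan sum_distrib_left)
  finally show ?thesis .
qed

text \<open>The anticommutation relations make the anticommutator a symmetric bilinear form in the
  coefficients. No conjugation occurs, also for complex \<open>x\<close> and
  \<open>y\<close>.\<close>

lemma lincomb_anticommutator:
  assumes v: "v \<in> carrier_vec d"
  shows "lincomb x *\<^sub>v (lincomb y *\<^sub>v v) + lincomb y *\<^sub>v (lincomb x *\<^sub>v v)
    = (2 * (\<Sum>j<2*N. x j * y j)) \<cdot>\<^sub>v v"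
proof (rule eq_vecI)
  fix r assume "r < dim_vec ((2 * (\<Sum>j<2*N. x j * y j)) \<cdot>\<^sub>v v)"
  then have r: "r < d" using v by simp
  have *: "(lincomb x *\<^sub>v (lincomb y *\<^sub>v v)) $ r
      = (\<Sum>j<2*N. \<Sum>k<2*N. x j * y k * (\<omega> j *\<^sub>v (\<omega> k *\<^sub>v v)) $ r)" for x y
  proof -
    have "(lincomb x *\<^sub>v (lincomb y *\<^sub>v v)) $ r
        = (\<Sum>j<2*N. x j * (\<omega> j *\<^sub>v (lincomb y *\<^sub>v v)) $ r)"
      by (rule lincomb_index) (use v r in auto)
    also have "\<dots> = (\<Sum>j<2*N. x j * (\<Sum>k<2*N. y k * (\<omega> j *\<^sub>v (\<omega> k *\<^sub>v v)) $ r))"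
      using v r by (intro sum.cong refl arg_cong2[of _ _ _ _ "(*)"] mult_lincomb_index) auto
    finally show ?thesis by (simp add: sum_distrib_left mult_ac del: index_mult_mat_vec)
  qed
  have "(lincomb x *\<^sub>v (lincomb y *\<^sub>v v) + lincomb y *\<^sub>v (lincomb x *\<^sub>v v)) $ r
    = (lincomb x *\<^sub>v (lincomb y *\<^sub>v v)) $ r + (lincomb y *\<^sub>v (lincomb x *\<^sub>v v)) $ r"
    using r by (intro index_add_vec) simp
  \<comment> \<open>Exchanging the summations in the second double sum gives both the coefficient
    \<open>x j * y k\<close>, so that each term contains one anticommutator.\<close>
  also have "\<dots> = (\<Sum>j<2*N. \<Sum>k<2*N. x j * y k * (\<omega> j *\<^sub>v (\<omega> k *\<^sub>v v)) $ r)
      + (\<Sum>j<2*N. \<Sum>k<2*N. x j * y k * (\<omega> k *\<^sub>v (\<omega> j *\<^sub>v v)) $ r)"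
    unfolding * by (subst (2) sum.swap) (simp add: mult_ac del: index_mult_mat_vec)
  also have "\<dots> = (\<Sum>j<2*N. \<Sum>k<2*N. x j * y k *
      ((\<omega> j *\<^sub>v (\<omega> k *\<^sub>v v)) $ r + (\<omega> k *\<^sub>v (\<omega> j *\<^sub>v v)) $ r))"
    by (simp add: sum.distrib distrib_left del: index_mult_mat_vec)
  also have "\<dots> = (\<Sum>j<2*N. \<Sum>k<2*N. if k = j then 2 * (x j * y j) * v $ r else 0)"
    using v r by (intro sum.cong) (auto simp: omega_anticommutator_vec simp del: index_mult_mat_vec)
  also have "\<dots> = ((2 * (\<Sum>j<2*N. x j * y j)) \<cdot>\<^sub>v v) $ r"
    using v r by (simp add: sum_distrib_left sum_distrib_right)
  finally show "(lincomb x *\<^sub>v (lincomb y *\<^sub>v v) + lincomb y *\<^sub>v (lincomb x *\<^sub>v v)) $ r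
    = ((2 * (\<Sum>j<2*N. x j * y j)) \<cdot>\<^sub>v v) $ r" .
qed (use v in simp)

lemma lincomb_delta:
  assumes "a < 2*N"
  shows "lincomb (\<lambda>j. if j = a then 1 else 0) = \<omega> a"
proof (rule eq_matI)
  fix r c assume "r < dim_row (\<omega> a)" "c < dim_col (\<omega> a)"
  then have "r < d" "c < d" using assms by auto
  moreover have "(\<Sum>j<2*N. (if j = a then 1 else 0) * \<omega> j $$ (r,c))
      = (\<Sum>j<2*N. if j = a then \<omega> j $$ (r,c) else 0)"
    by (intro sum.cong) auto
  ultimately show "lincomb (\<lambda>j. if j = a then 1 else 0) $$ (r,c) = \<omega> a $$ (r,c)"
    using assms by (simp add: lincomb_def)
qed (use assms in auto)

lemma lincomb_adjoint:
  assumes "v \<in> carrier_vec d" "w \<in> carrier_vec d"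
  shows "(lincomb x *\<^sub>v v) \<bullet>c w = v \<bullet>c (lincomb (\<lambda>j. cnj (x j)) *\<^sub>v w)"
proof (rule adjoint_inner[OF _ _ assms])
  fix r c assume rc: "r < d" "c < d"
  have "(\<Sum>j<2*N. cnj (x j) * \<omega> j $$ (r,c)) = (\<Sum>j<2*N. cnj (x j) * cnj (\<omega> j $$ (c,r)))"
    using rc by (intro sum.cong refl arg_cong2[of _ _ _ _ "(*)"] omega_hermitian) auto
  then show "lincomb (\<lambda>j. cnj (x j)) $$ (r,c) = cnj (lincomb x $$ (c,r))"
    using rc by (simp add: lincomb_def)
qed auto

lemma omega_adjoint:
  assumes "a < 2*N" "v \<in> carrier_vec d" "w \<in> carrier_vec d"
  shows "(\<omega> a *\<^sub>v v) \<bullet>c w = v \<bullet>c (\<omega> a *\<^sub>v w)"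
  using adjoint_inner[OF omega_carrier omega_carrier assms(2,3)] assms(1) omega_hermitian by blast

end

section \<open>Rotated Majorana operators, mode parities and their joint eigenvectors\<close>

locale majorana_frame = majorana +
  fixes Q :: "nat \<Rightarrow> nat \<Rightarrow> real"
  assumes Q_rows: "\<And>k l. k < 2*N \<Longrightarrow> l < 2*N \<Longrightarrow> (\<Sum>j<2*N. Q k j * Q l j) = (if k = l then 1 else 0)"
    and Q_cols: "\<And>i j. i < 2*N \<Longrightarrow> j < 2*N \<Longrightarrow> (\<Sum>k<2*N. Q k i * Q k j) = (if i = j then 1 else 0)"
begin

text \<open>A map on vectors, so that operator products become compositions. Orthonormal rows of
  \<open>Q\<close> give the anticommutation relations of these maps; orthonormal columns recover the
  original operators from them.\<close>

definition \<gamma> :: "nat \<Rightarrow> complex vec \<Rightarrow> complex vec" where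
  "\<gamma> k v = lincomb (\<lambda>j. complex_of_real (Q k j)) *\<^sub>v v"

lemma gamma_carrier [simp]: "v \<in> carrier_vec d \<Longrightarrow> \<gamma> k v \<in> carrier_vec d"
  by (simp add: \<gamma>_def)

lemma gamma_dim [simp]: "v \<in> carrier_vec d \<Longrightarrow> dim_vec (\<gamma> k v) = d"
  by (rule carrier_vecD) simp

lemma gamma_smult: "v \<in> carrier_vec d \<Longrightarrow> \<gamma> k (c \<cdot>\<^sub>v v) = c \<cdot>\<^sub>v \<gamma> k v"
  unfolding \<gamma>_def by (rule mult_mat_vec[OF lincomb_carrier])

lemma gamma_add:
  "v \<in> carrier_vec d \<Longrightarrow> w \<in> carrier_vec d \<Longrightarrow> \<gamma> k (v + w) = \<gamma> k v + \<gamma> k w"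
  unfolding \<gamma>_def by (rule mult_add_distrib_mat_vec[OF lincomb_carrier])

lemma gamma_anticommutator:
  assumes "k < 2*N" "l < 2*N" "v \<in> carrier_vec d"
  shows "\<gamma> k (\<gamma> l v) + \<gamma> l (\<gamma> k v) = (if k = l then 2 else 0) \<cdot>\<^sub>v v"
proof -
  have "(\<Sum>j<2*N. complex_of_real (Q k j) * complex_of_real (Q l j)) = (if k = l then 1 else 0)"
    unfolding of_real_mult[symmetric] of_real_sum[symmetric] Q_rows[OF assms(1,2)] by simp
  then show ?thesis unfolding \<gamma>_def lincomb_anticommutator[OF assms(3)] by simp
qed

lemma gamma_square:
  assumes "k < 2*N" "v \<in> carrier_vec d"
  shows "\<gamma> k (\<gamma> k v) = v"
proof (rule eq_vecI)
  fix r assume r: "r < dim_vec v"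
  have "(\<gamma> k (\<gamma> k v) + \<gamma> k (\<gamma> k v)) $ r = (2 \<cdot>\<^sub>v v) $ r"
    using gamma_anticommutator[OF assms(1,1,2)] by simp
  then show "\<gamma> k (\<gamma> k v) $ r = v $ r" using r assms by simp
qed (use assms in simp)

lemma gamma_swap:
  assumes "k < 2*N" "l < 2*N" "k \<noteq> l" "v \<in> carrier_vec d"
  shows "\<gamma> k (\<gamma> l v) = (- 1) \<cdot>\<^sub>v \<gamma> l (\<gamma> k v)"
proof (rule eq_vecI)
  show "dim_vec (\<gamma> k (\<gamma> l v)) = dim_vec ((- 1) \<cdot>\<^sub>v \<gamma> l (\<gamma> k v))" using assms by simp
  fix r assume "r < dim_vec ((- 1) \<cdot>\<^sub>v \<gamma> l (\<gamma> k v))"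
  then have r: "r < d" using assms by simp
  have "(\<gamma> k (\<gamma> l v) + \<gamma> l (\<gamma> k v)) $ r = (0 \<cdot>\<^sub>v v) $ r"
    using gamma_anticommutator[OF assms(1,2,4)] assms(3) by simp
  then show "\<gamma> k (\<gamma> l v) $ r = ((- 1) \<cdot>\<^sub>v \<gamma> l (\<gamma> k v)) $ r"
    using r assms(4) by (simp add: eq_neg_iff_add_eq_0)
qed

lemma gamma_adjoint:
  assumes "v \<in> carrier_vec d" "w \<in> carrier_vec d"
  shows "\<gamma> k v \<bullet>c w = v \<bullet>c \<gamma> k w"
  using lincomb_adjoint[OF assms, of "\<lambda>j. complex_of_real (Q k j)"] unfolding \<gamma>_def by simp

text \<open>For the mode f with \<open>\<gamma> (2*k)\<close> = f^dagger + f and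
  \<open>\<gamma> (2*k+1)\<close> = -i (f^dagger - f), this is the parity 1 - 2 f^dagger f.\<close>

definition Z :: "nat \<Rightarrow> complex vec \<Rightarrow> complex vec" where
  "Z k v = \<i> \<cdot>\<^sub>v \<gamma> (2*k) (\<gamma> (2*k+1) v)"

lemma Z_carrier [simp]: "v \<in> carrier_vec d \<Longrightarrow> Z k v \<in> carrier_vec d"
  by (simp add: Z_def)

lemma Z_dim [simp]: "v \<in> carrier_vec d \<Longrightarrow> dim_vec (Z k v) = d"
  by (rule carrier_vecD) simp

lemma Z_smult: "v \<in> carrier_vec d \<Longrightarrow> Z k (c \<cdot>\<^sub>v v) = c \<cdot>\<^sub>v Z k v"
  by (simp add: Z_def gamma_smult smult_smult_assoc mult.commute)

lemma Z_add: "v \<in> carrier_vec d \<Longrightarrow> w \<in> carrier_vec d \<Longrightarrow> Z k (v + w) = Z k v + Z k w"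
  by (simp add: Z_def gamma_add smult_add_distrib_vec[of _ d])

text \<open>Passing two distinct factors produces two signs, which cancel.\<close>

lemma Z_gamma_commute:
  assumes "k < N" "l < 2*N" "l \<noteq> 2*k" "l \<noteq> 2*k+1" "v \<in> carrier_vec d"
  shows "Z k (\<gamma> l v) = \<gamma> l (Z k v)"
proof -
  have "\<gamma> (2*k) (\<gamma> (2*k+1) (\<gamma> l v)) = \<gamma> (2*k) ((- 1) \<cdot>\<^sub>v \<gamma> l (\<gamma> (2*k+1) v))"
    using assms gamma_swap[of "2*k+1" l v] by simp
  also have "\<dots> = (- 1) \<cdot>\<^sub>v ((- 1) \<cdot>\<^sub>v \<gamma> l (\<gamma> (2*k) (\<gamma> (2*k+1) v)))"
    using assms gamma_swap[of "2*k" l "\<gamma> (2*k+1) v"] by (simp add: gamma_smult)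
  finally show ?thesis using assms(5) by (simp add: Z_def gamma_smult smult_smult_assoc)
qed

text \<open>Only the partner factor contributes a sign, so \<open>\<gamma> (2*k)\<close> exchanges
  the two eigenspaces of \<open>Z k\<close>.\<close>

lemma Z_gamma_anticommute:
  assumes "k < N" "v \<in> carrier_vec d"
  shows "Z k (\<gamma> (2*k) v) = (- 1) \<cdot>\<^sub>v \<gamma> (2*k) (Z k v)"
  using assms gamma_swap[of "2*k+1" "2*k" v]
  by (simp add: Z_def gamma_smult smult_smult_assoc)

lemma Z_square:
  assumes "k < N" "v \<in> carrier_vec d"
  shows "Z k (Z k v) = v"
proof -
  have "Z k (Z k v) = \<i> \<cdot>\<^sub>v Z k (\<gamma> (2*k) (\<gamma> (2*k+1) v))"
    unfolding Z_def[of k v] using assms by (simp add: Z_smult)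
  also have "Z k (\<gamma> (2*k) (\<gamma> (2*k+1) v)) = (- 1) \<cdot>\<^sub>v \<gamma> (2*k) (Z k (\<gamma> (2*k+1) v))"
    using assms by (simp add: Z_gamma_anticommute)
  also have "Z k (\<gamma> (2*k+1) v) = \<i> \<cdot>\<^sub>v \<gamma> (2*k) v"
    using assms gamma_square[of "2*k+1" v] by (simp add: Z_def)
  finally show ?thesis using assms gamma_square[of "2*k" v]
    by (simp add: gamma_smult smult_smult_assoc)
qed

lemma Z_commute:
  assumes "k < N" "l < N" "k \<noteq> l" "v \<in> carrier_vec d"
  shows "Z k (Z l v) = Z l (Z k v)"
proof -
  have ne: "2*l \<noteq> 2*k" "2*l \<noteq> 2*k+1" "2*l+1 \<noteq> 2*k" "2*l+1 \<noteq> 2*k+1"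
    using assms(3) by presburger+
  have "Z k (Z l v) = \<i> \<cdot>\<^sub>v Z k (\<gamma> (2*l) (\<gamma> (2*l+1) v))"
    unfolding Z_def[of l v] using assms by (simp add: Z_smult)
  also have "\<dots> = \<i> \<cdot>\<^sub>v \<gamma> (2*l) (\<gamma> (2*l+1) (Z k v))"
    using assms ne Z_gamma_commute[of k "2*l" "\<gamma> (2*l+1) v"] Z_gamma_commute[of k "2*l+1" v] by simp
  finally show ?thesis unfolding Z_def[of l] .
qed

text \<open>Taking adjoints reverses the two anticommuting factors, and the resulting sign is
  compensated by the conjugation of the imaginary unit.\<close>

lemma Z_adjoint:
  assumes "k < N" "v \<in> carrier_vec d" "w \<in> carrier_vec d"
  shows "Z k v \<bullet>c w = v \<bullet>c Z k w"
proof -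
  have "Z k v \<bullet>c w = \<i> * (\<gamma> (2*k) (\<gamma> (2*k+1) v) \<bullet>c w)"
    unfolding Z_def using assms by (intro smult_scalar_prod_distrib[of _ d]) auto
  also have "\<gamma> (2*k) (\<gamma> (2*k+1) v) \<bullet>c w = v \<bullet>c \<gamma> (2*k+1) (\<gamma> (2*k) w)"
    using assms by (simp add: gamma_adjoint)
  also have "\<gamma> (2*k+1) (\<gamma> (2*k) w) = (- 1) \<cdot>\<^sub>v \<gamma> (2*k) (\<gamma> (2*k+1) w)"
    using assms by (intro gamma_swap) auto
  also have "\<i> * (v \<bullet>c ((- 1) \<cdot>\<^sub>v \<gamma> (2*k) (\<gamma> (2*k+1) w))) = v \<bullet>c Z k w"
    unfolding Z_def conjugate_smult_vec using assms
    by (subst (1 2) scalar_prod_smult_distrib[of _ d]) auto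
  finally show ?thesis .
qed

text \<open>The signs are imposed one by one. Either the projection of \<open>v\<close> to the
  wanted eigenspace of \<open>Z K\<close> is nonzero, or \<open>v\<close> has the opposite sign,
  which \<open>\<gamma> (2*K)\<close> repairs; both operations preserve the earlier
  eigenvalues.\<close>

lemma Z_joint_eigenvector_partial:
  assumes z: "\<And>k. k < N \<Longrightarrow> z k * z k = (1::complex)" and "K \<le> N"
  shows "\<exists>v. v \<in> carrier_vec d \<and> v \<noteq> 0\<^sub>v d \<and> (\<forall>k<K. Z k v = z k \<cdot>\<^sub>v v)"
  using \<open>K \<le> N\<close>
proof (induction K)
  case 0
  have "unit_vec d 0 \<noteq> (0\<^sub>v d :: complex vec)"
    by (rule unit_vec_nonzero) (simp add: fock_dim_def)
  then show ?case using unit_vec_carrier by blast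
next
  case (Suc K)
  then obtain v where v: "v \<in> carrier_vec d" "v \<noteq> 0\<^sub>v d" and ev: "\<And>k. k < K \<Longrightarrow> Z k v = z k \<cdot>\<^sub>v v"
    by auto
  have K: "K < N" using Suc.prems by simp
  have zz: "z K * z K = 1" using z K by simp
  \<comment> \<open>Twice the projection of \<open>v\<close> to the eigenspace of \<open>Z K\<close>
    for \<open>z K\<close>, because \<open>Z K\<close> is an involution and \<open>z K\<close> is
    its own inverse.\<close>
  define u where "u = v + z K \<cdot>\<^sub>v Z K v"
  show ?case
  proof (cases "u = 0\<^sub>v d")
    case False
    have uc: "u \<in> carrier_vec d" using v by (simp add: u_def)
    have "Z K u = z K \<cdot>\<^sub>v u"
    proof -
      have "Z K u = Z K v + z K \<cdot>\<^sub>v v"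
        unfolding u_def using v K by (simp add: Z_add Z_smult Z_square)
      also have "\<dots> = z K \<cdot>\<^sub>v v + (z K * z K) \<cdot>\<^sub>v Z K v"
        using v zz by (simp add: comm_add_vec[of _ d])
      also have "\<dots> = z K \<cdot>\<^sub>v u"
        unfolding u_def using v by (simp add: smult_add_distrib_vec[of _ d] smult_smult_assoc)
      finally show ?thesis .
    qed
    moreover have "Z k u = z k \<cdot>\<^sub>v u" if "k < K" for k
    proof -
      have "Z k u = z k \<cdot>\<^sub>v v + z K \<cdot>\<^sub>v Z K (z k \<cdot>\<^sub>v v)"
        unfolding u_def using v K that Z_commute[of k K v] by (simp add: Z_add Z_smult ev)
      then show ?thesis
        unfolding u_def using v
        by (simp add: Z_smult smult_add_distrib_vec[of _ d] smult_smult_assoc mult.commute)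
    qed
    ultimately show ?thesis using uc False less_Suc_eq by blast
  next
    case True
    have Zv: "Z K v = (- z K) \<cdot>\<^sub>v v"
    proof (rule eq_vecI)
      fix r assume "r < dim_vec ((- z K) \<cdot>\<^sub>v v)"
      then have r: "r < d" using v by simp
      have "v $ r + z K * Z K v $ r = 0"
        using arg_cong[OF True, of "\<lambda>v. v $ r"] r v by (simp add: u_def)
      then have "z K * v $ r + (z K * z K) * Z K v $ r = 0"
        by (metis distrib_left mult.assoc mult_zero_right)
      then show "Z K v $ r = ((- z K) \<cdot>\<^sub>v v) $ r"
        using r v zz by (simp add: add_eq_0_iff)
    qed (use v in simp)
    \<comment> \<open>The flipped vector is nonzero because \<open>\<gamma> (2*K)\<close> is an
      involution and maps it back to \<open>v\<close>.\<close>
    define w where "w = \<gamma> (2*K) v"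
    have wc: "w \<in> carrier_vec d" using v by (simp add: w_def)
    have gw: "\<gamma> (2*K) w = v" unfolding w_def using K v by (simp add: gamma_square)
    have "w \<noteq> 0\<^sub>v d"
    proof
      assume "w = 0\<^sub>v d"
      then have "w = 0 \<cdot>\<^sub>v v" using v by auto
      then have "\<gamma> (2*K) w = 0 \<cdot>\<^sub>v \<gamma> (2*K) v" using v by (simp add: gamma_smult)
      then have "v = 0 \<cdot>\<^sub>v w" using gw w_def by simp
      then show False using v wc by auto
    qed
    moreover have "Z K w = z K \<cdot>\<^sub>v w"
      unfolding w_def using K v Zv by (simp add: Z_gamma_anticommute gamma_smult smult_smult_assoc)
    moreover have "Z k w = z k \<cdot>\<^sub>v w" if "k < K" for k
      unfolding w_def using K v that Z_gamma_commute[of k "2*K" v]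
      by (simp add: ev gamma_smult)
    ultimately show ?thesis using wc less_Suc_eq by blast
  qed
qed

lemma Z_joint_eigenvector:
  assumes "\<And>k. k < N \<Longrightarrow> z k * z k = (1::complex)"
  obtains v where "v \<in> carrier_vec d" "v \<bullet>c v = 1" "\<And>k. k < N \<Longrightarrow> Z k v = z k \<cdot>\<^sub>v v"
proof -
  obtain v where v: "v \<in> carrier_vec d" "v \<noteq> 0\<^sub>v d" and ev: "\<forall>k<N. Z k v = z k \<cdot>\<^sub>v v"
    using Z_joint_eigenvector_partial[of z N] assms by blast
  have pos: "v \<bullet>c v > 0" using conjugate_square_greater_0_vec[OF v(1)] v(2) by simp
  define p where "p = Re (v \<bullet>c v)"
  have p: "p > 0" "v \<bullet>c v = complex_of_real p"
    using pos by (auto simp: p_def less_complex_def complex_eq_iff)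
  define c where "c = complex_of_real (1 / sqrt p)"
  have cc: "c * cnj c * complex_of_real p = 1"
    using p(1) by (simp add: c_def flip: of_real_mult)
  show ?thesis
  proof (rule that[of "c \<cdot>\<^sub>v v"])
    show "c \<cdot>\<^sub>v v \<in> carrier_vec d" using v by simp
    show "(c \<cdot>\<^sub>v v) \<bullet>c (c \<cdot>\<^sub>v v) = 1"
      using v cc p(2) by (simp add: conjugate_smult_vec mult_ac)
    show "Z k (c \<cdot>\<^sub>v v) = z k \<cdot>\<^sub>v (c \<cdot>\<^sub>v v)" if "k < N" for k
      using v ev that by (simp add: Z_smult smult_smult_assoc mult.commute)
  qed
qed

end

section \<open>Wick's theorem\<close>

lemma sum_delta_mult:
  fixes x :: "nat \<Rightarrow> complex"
  assumes "a < n"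
  shows "(\<Sum>j<n. (if j = a then 1 else 0) * x j) = x a"
proof -
  have "(\<Sum>j<n. (if j = a then 1 else 0) * x j) = (\<Sum>j<n. if j = a then x j else 0)"
    by (intro sum.cong) auto
  then show ?thesis using assms by simp
qed

context majorana
begin

lemma mono_list_simps [simp]:
  "mono_list N \<omega> [] = 1\<^sub>m d"
  "mono_list N \<omega> (a # js) = \<omega> a * mono_list N \<omega> js"
  by (simp_all add: mono_list_def)

lemma mono_list_carrier [simp]:
  "set js \<subseteq> {..<2*N} \<Longrightarrow> mono_list N \<omega> js \<in> carrier_mat d d"
  by (induction js) (auto intro!: mult_carrier_mat[of _ _ d])

lemma mono_list_dim [simp]:
  "set js \<subseteq> {..<2*N} \<Longrightarrow> dim_row (mono_list N \<omega> js) = d"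
  "set js \<subseteq> {..<2*N} \<Longrightarrow> dim_col (mono_list N \<omega> js) = d"
  using mono_list_carrier by blast+

lemma mono_list_vec_carrier [simp]:
  "set js \<subseteq> {..<2*N} \<Longrightarrow> v \<in> carrier_vec d \<Longrightarrow> mono_list N \<omega> js *\<^sub>v v \<in> carrier_vec d"
  by (rule mult_mat_vec_carrier[OF mono_list_carrier])

lemma mono_list_Cons_vec:
  assumes "a < 2*N" "set js \<subseteq> {..<2*N}" "v \<in> carrier_vec d"
  shows "mono_list N \<omega> (a # js) *\<^sub>v v = \<omega> a *\<^sub>v (mono_list N \<omega> js *\<^sub>v v)"
  using assoc_mult_mat_vec[OF omega_carrier[OF assms(1)] mono_list_carrier[OF assms(2)] assms(3)]
  by simp

lemma expect_one:
  assumes "\<psi> \<in> carrier_vec d"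
  shows "expect \<psi> (1\<^sub>m d) = \<psi> \<bullet>c \<psi>"
  using assms by (simp add: expect_inner[of _ d])

end

text \<open>The relation \<open>\<omega>\<^sub>a E = \<i> \<Sum>\<^sub>b J\<^sub>a\<^sub>b \<omega>\<^sub>b E\<close> says that
  \<open>D\<^sub>a = (\<omega>\<^sub>a - \<i> \<Sum>\<^sub>b J\<^sub>a\<^sub>b \<omega>\<^sub>b) / 2\<close> annihilates \<open>E\<close>, where
  \<open>\<omega>\<^sub>a\<close> is the sum of \<open>D\<^sub>a\<close> and its adjoint.\<close>

locale gaussian_relation = majorana +
  fixes E :: "complex vec" and J :: "nat \<Rightarrow> nat \<Rightarrow> real"
  assumes E_carrier [simp]: "E \<in> carrier_vec d" and E_unit: "E \<bullet>c E = 1"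
    and E_relation: "\<And>a r. a < 2*N \<Longrightarrow> r < d \<Longrightarrow>
      (\<omega> a *\<^sub>v E) $ r = \<i> * (\<Sum>b<2*N. complex_of_real (J a b) * (\<omega> b *\<^sub>v E) $ r)"
begin

definition annih_coeff :: "nat \<Rightarrow> nat \<Rightarrow> complex" where
  "annih_coeff a b = ((if b = a then 1 else 0) - \<i> * complex_of_real (J a b)) / 2"

definition D :: "nat \<Rightarrow> complex mat" where
  "D a = lincomb (annih_coeff a)"

text \<open>The scalar anticommutator of \<open>D a\<close> and \<open>\<omega> b\<close>; it turns
  out to be the expectation of \<open>\<omega> a * \<omega> b\<close> in \<open>E\<close>.\<close>

definition two_point :: "nat \<Rightarrow> nat \<Rightarrow> complex" where
  "two_point a b = (if a = b then 1 else 0) - \<i> * complex_of_real (J a b)"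

lemma D_vec_carrier [simp]: "v \<in> carrier_vec d \<Longrightarrow> D a *\<^sub>v v \<in> carrier_vec d"
  by (simp add: D_def)

lemma D_annihilates:
  assumes "a < 2*N"
  shows "D a *\<^sub>v E = 0\<^sub>v d"
proof (rule eq_vecI)
  fix r assume "r < dim_vec (0\<^sub>v d :: complex vec)"
  then have r: "r < d" by simp
  have "(D a *\<^sub>v E) $ r = (\<Sum>b<2*N. annih_coeff a b * (\<omega> b *\<^sub>v E) $ r)"
    unfolding D_def using r by (intro lincomb_index) auto
  also have "\<dots> = ((\<Sum>b<2*N. (if b = a then 1 else 0) * (\<omega> b *\<^sub>v E) $ r)
      - \<i> * (\<Sum>b<2*N. complex_of_real (J a b) * (\<omega> b *\<^sub>v E) $ r)) / 2"
    unfolding annih_coeff_def sum_distrib_left sum_subtractf[symmetric] sum_divide_distrib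
    by (intro sum.cong refl) (simp add: field_simps del: index_mult_mat_vec)
  also have "\<dots> = 0" unfolding sum_delta_mult[OF assms] using E_relation[OF assms r] by simp
  finally show "(D a *\<^sub>v E) $ r = 0\<^sub>v d $ r" using r by simp
qed (simp add: D_def)

text \<open>Since \<open>J\<close> is real, the coefficients of \<open>D a\<close> and of its
  adjoint add up to those of \<open>\<omega> a\<close>. The adjoint part disappears when moved to
  the right, where it becomes \<open>D a\<close> acting on \<open>E\<close>.\<close>

lemma omega_inner_annihilator:
  assumes "a < 2*N" and v: "v \<in> carrier_vec d"
  shows "(\<omega> a *\<^sub>v v) \<bullet>c E = (D a *\<^sub>v v) \<bullet>c E"
proof -
  let ?C = "lincomb (\<lambda>b. cnj (annih_coeff a b))"
  have "\<omega> a *\<^sub>v v = D a *\<^sub>v v + ?C *\<^sub>v v"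
  proof (rule eq_vecI)
    fix r assume "r < dim_vec (D a *\<^sub>v v + ?C *\<^sub>v v)"
    then have r: "r < d" by simp
    have "(D a *\<^sub>v v + ?C *\<^sub>v v) $ r = (D a *\<^sub>v v) $ r + (?C *\<^sub>v v) $ r"
      using r by (intro index_add_vec) simp
    also have "\<dots> = (\<Sum>b<2*N. (if b = a then 1 else 0) * (\<omega> b *\<^sub>v v) $ r)"
      unfolding D_def lincomb_index[OF v r] sum.distrib[symmetric]
      by (intro sum.cong refl) (simp add: annih_coeff_def field_simps del: index_mult_mat_vec)
    finally show "(\<omega> a *\<^sub>v v) $ r = (D a *\<^sub>v v + ?C *\<^sub>v v) $ r"
      unfolding sum_delta_mult[OF assms(1)] ..
  qed (use assms in simp)
  then have "(\<omega> a *\<^sub>v v) \<bullet>c E = (D a *\<^sub>v v) \<bullet>c E + (?C *\<^sub>v v) \<bullet>c E"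
    using v by (simp add: add_scalar_prod_distrib[of _ d])
  also have "(?C *\<^sub>v v) \<bullet>c E = v \<bullet>c (D a *\<^sub>v E)"
    using lincomb_adjoint[OF v E_carrier, of "\<lambda>b. cnj (annih_coeff a b)"] by (simp add: D_def)
  also have "\<dots> = 0" using D_annihilates[OF assms(1)] v by simp
  finally show ?thesis by simp
qed

lemma D_omega_anticommutator:
  assumes "b < 2*N" and v: "v \<in> carrier_vec d"
  shows "D a *\<^sub>v (\<omega> b *\<^sub>v v) + \<omega> b *\<^sub>v (D a *\<^sub>v v) = two_point a b \<cdot>\<^sub>v v"
proof -
  have "2 * (\<Sum>j<2*N. annih_coeff a j * (if j = b then 1 else 0)) = two_point a b"
    using sum_delta_mult[OF assms(1), of "annih_coeff a"]
    by (auto simp: mult.commute annih_coeff_def two_point_def)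
  then show ?thesis
    using lincomb_anticommutator[OF v, of "annih_coeff a" "\<lambda>j. if j = b then 1 else 0"]
    unfolding lincomb_delta[OF assms(1)] D_def by simp
qed

text \<open>\<open>D a\<close> is anticommuted to the right until it meets \<open>E\<close>, each
  exchange leaving a scalar and a sign. The right vector \<open>\<phi>\<close> is arbitrary because
  the induction has to absorb the leading Majorana operators into it.\<close>

lemma D_mono_list_inner:
  assumes "a < 2*N" "set js \<subseteq> {..<2*N}" "\<phi> \<in> carrier_vec d"
  shows "(D a *\<^sub>v (mono_list N \<omega> js *\<^sub>v E)) \<bullet>c \<phi> = (\<Sum>i<length js. (-1)^i * two_point a (js ! i)
     * ((mono_list N \<omega> (take i js @ drop (Suc i) js) *\<^sub>v E) \<bullet>c \<phi>))"
  using assms(2,3)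
proof (induction js arbitrary: \<phi>)
  case Nil
  then show ?case using D_annihilates[OF assms(1)] by simp
next
  case (Cons b js)
  then have b: "b < 2*N" and js: "set js \<subseteq> {..<2*N}" by auto
  let ?w = "mono_list N \<omega> js *\<^sub>v E"
  have w: "?w \<in> carrier_vec d" using js by simp
  have rest: "set (take i js @ drop (Suc i) js) \<subseteq> {..<2*N}" for i
    using js by (auto dest: in_set_takeD in_set_dropD)
  have "(D a *\<^sub>v (\<omega> b *\<^sub>v ?w) + \<omega> b *\<^sub>v (D a *\<^sub>v ?w)) \<bullet>c \<phi>
      = (D a *\<^sub>v (\<omega> b *\<^sub>v ?w)) \<bullet>c \<phi> + (\<omega> b *\<^sub>v (D a *\<^sub>v ?w)) \<bullet>c \<phi>"
    using w b Cons.prems by (intro add_scalar_prod_distrib[of _ d]) auto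
  \<comment> \<open>Moving \<open>\<omega> b\<close> to the right vector leaves \<open>D a\<close>
    in front of the shorter monomial, as the induction hypothesis requires; afterwards
    \<open>\<omega> b\<close> moves back.\<close>
  also have "(\<omega> b *\<^sub>v (D a *\<^sub>v ?w)) \<bullet>c \<phi> = (D a *\<^sub>v ?w) \<bullet>c (\<omega> b *\<^sub>v \<phi>)"
    using w b Cons.prems by (intro omega_adjoint) auto
  finally have "(D a *\<^sub>v (\<omega> b *\<^sub>v ?w)) \<bullet>c \<phi>
      = two_point a b * (?w \<bullet>c \<phi>) - (D a *\<^sub>v ?w) \<bullet>c (\<omega> b *\<^sub>v \<phi>)"
    unfolding D_omega_anticommutator[OF b w] using w Cons.prems
    by (simp add: smult_scalar_prod_distrib[of _ d])
  also have "(D a *\<^sub>v ?w) \<bullet>c (\<omega> b *\<^sub>v \<phi>) = (\<Sum>i<length js. (-1)^i * two_point a (js ! i)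
     * ((mono_list N \<omega> (take i js @ drop (Suc i) js) *\<^sub>v E) \<bullet>c (\<omega> b *\<^sub>v \<phi>)))"
    using Cons.prems b by (intro Cons.IH[OF js]) simp
  also have "\<dots> = (\<Sum>i<length js. (-1)^i * two_point a (js ! i)
     * ((mono_list N \<omega> (b # take i js @ drop (Suc i) js) *\<^sub>v E) \<bullet>c \<phi>))"
  proof (intro sum.cong refl arg_cong2[of _ _ _ _ "(*)"])
    fix i
    show "(mono_list N \<omega> (take i js @ drop (Suc i) js) *\<^sub>v E) \<bullet>c (\<omega> b *\<^sub>v \<phi>)
      = (mono_list N \<omega> (b # take i js @ drop (Suc i) js) *\<^sub>v E) \<bullet>c \<phi>"
      unfolding mono_list_Cons_vec[OF b rest E_carrier]
      using rest b Cons.prems by (intro omega_adjoint[symmetric]) auto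
  qed
  finally show ?case
    unfolding mono_list_Cons_vec[OF b js E_carrier] length_Cons sum.lessThan_Suc_shift
    by (simp add: sum_negf del: mono_list_simps(2))
qed

text \<open>This is the recursion that defines \<open>pf\<close>, with \<open>two_point\<close> as
  the array.\<close>

lemma expect_mono_list_Cons:
  assumes "a < 2*N" "set js \<subseteq> {..<2*N}"
  shows "expect E (mono_list N \<omega> (a # js)) = (\<Sum>i<length js. (-1)^i * two_point a (js ! i)
     * expect E (mono_list N \<omega> (take i js @ drop (Suc i) js)))"
proof -
  have rest: "set (take i js @ drop (Suc i) js) \<subseteq> {..<2*N}" for i
    using assms(2) by (auto dest: in_set_takeD in_set_dropD)
  have "set (a # js) \<subseteq> {..<2*N}" using assms by simp
  then have "expect E (mono_list N \<omega> (a # js)) = (mono_list N \<omega> (a # js) *\<^sub>v E) \<bullet>c E"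
    by (intro expect_inner[OF mono_list_carrier E_carrier])
  also have "\<dots> = (D a *\<^sub>v (mono_list N \<omega> js *\<^sub>v E)) \<bullet>c E"
    unfolding mono_list_Cons_vec[OF assms E_carrier] using assms
    by (intro omega_inner_annihilator) auto
  also have "\<dots> = (\<Sum>i<length js. (-1)^i * two_point a (js ! i)
     * ((mono_list N \<omega> (take i js @ drop (Suc i) js) *\<^sub>v E) \<bullet>c E))"
    using assms by (intro D_mono_list_inner) auto
  finally show ?thesis
    by (simp only: expect_inner[OF mono_list_carrier[OF rest] E_carrier])
qed

lemma expect_two_point:
  assumes "a < 2*N" "b < 2*N"
  shows "expect E (\<omega> a * \<omega> b) = two_point a b"
  using expect_mono_list_Cons[of a "[b]"] assms E_unit
  by (simp add: expect_one[OF E_carrier])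

text \<open>Induction on the length, because the recursion removes an inner entry besides the head
  and thus does not descend to tails.\<close>

lemma expect_mono_list_pf:
  assumes "set js \<subseteq> {..<2*N}"
  shows "expect E (mono_list N \<omega> js) = pf (\<lambda>a b. expect E (\<omega> a * \<omega> b)) js"
  using assms
proof (induction "length js" arbitrary: js rule: less_induct)
  case less
  show ?case
  proof (cases js)
    case Nil
    then show ?thesis using E_unit by (simp add: expect_one[OF E_carrier])
  next
    case (Cons a xs)
    then have a: "a < 2*N" and xs: "set xs \<subseteq> {..<2*N}" using less.prems by auto
    have rest: "set (take i xs @ drop (Suc i) xs) \<subseteq> {..<2*N}" for i
      using xs by (auto dest: in_set_takeD in_set_dropD)
    show ?thesis
      unfolding Cons expect_mono_list_Cons[OF a xs] pf.simps(2)
    proof (intro sum.cong refl arg_cong2[of _ _ _ _ "(*)"])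
      fix i assume "i \<in> {..<length xs}"
      then have i: "i < length xs" by simp
      then have "xs ! i < 2*N" using xs nth_mem by blast
      then show "two_point a (xs ! i) = expect E (\<omega> a * \<omega> (xs ! i))"
        using expect_two_point[OF a] by simp
      show "expect E (mono_list N \<omega> (take i xs @ drop (Suc i) xs))
          = pf (\<lambda>a b. expect E (\<omega> a * \<omega> b)) (take i xs @ drop (Suc i) xs)"
        by (rule less.hyps[OF _ rest]) (use i Cons in auto)
    qed
  qed
qed

lemma pure_gaussian_E: "pure_gaussian N \<omega> E"
  unfolding pure_gaussian_def gaussian_state_def mono_def
proof (intro conjI allI impI)
  fix S assume "S \<subseteq> {..<2*N}"
  then have "set (sorted_list_of_set S) \<subseteq> {..<2*N}"
    using finite_subset[OF _ finite_lessThan] by (metis set_sorted_list_of_set)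
  then show "expect E (mono_list N \<omega> (sorted_list_of_set S))
      = pf (\<lambda>a b. expect E (\<omega> a * \<omega> b)) (sorted_list_of_set S)"
    by (rule expect_mono_list_pf)
qed (auto simp: E_unit)

text \<open>The commutator only sees the antisymmetric part of \<open>J\<close>. For an
  antisymmetric \<open>J\<close>, such as the one built from the rotated pairs, the covariance is
  \<open>J\<close> itself.\<close>

lemma covariance_E:
  assumes "j < 2*N" "k < 2*N"
  shows "covariance \<omega> E j k = (complex_of_real (J j k) - complex_of_real (J k j)) / 2"
proof -
  have c: "\<omega> j * \<omega> k \<in> carrier_mat d d" "\<omega> k * \<omega> j \<in> carrier_mat d d"
    using mult_carrier_mat[OF omega_carrier omega_carrier] assms by auto
  have "expect E (\<omega> j * \<omega> k - \<omega> k * \<omega> j) = expect E (\<omega> j * \<omega> k) - expect E (\<omega> k * \<omega> j)"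
    using c unfolding expect_def
    by (simp add: minus_mult_distrib_mat_vec[of _ d d] scalar_prod_minus_distrib[of _ d])
  also have "\<dots> = \<i> * (complex_of_real (J k j) - complex_of_real (J j k))"
    unfolding expect_two_point[OF assms] expect_two_point[OF assms(2,1)]
    by (auto simp: two_point_def algebra_simps)
  finally show ?thesis
    unfolding covariance_def by (simp only:) (simp add: field_simps)
qed

end

section \<open>Traces, entropy and maximally mixed reductions\<close>

lemma mtrace_mult_commute:
  assumes "A \<in> carrier_mat n n" "B \<in> carrier_mat n n"
  shows "mtrace (A * B) = mtrace (B * A)"
proof -
  have "mtrace (A * B) = (\<Sum>i<n. \<Sum>k<n. A $$ (i,k) * B $$ (k,i))"
    using assms by (simp add: mtrace_def scalar_prod_def atLeast0LessThan)
  also have "\<dots> = (\<Sum>k<n. \<Sum>i<n. A $$ (i,k) * B $$ (k,i))" by (rule sum.swap)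
  also have "\<dots> = mtrace (B * A)"
    using assms by (simp add: mtrace_def scalar_prod_def atLeast0LessThan mult.commute)
  finally show ?thesis .
qed

lemma mtrace_smult: "mtrace (c \<cdot>\<^sub>m A) = c * mtrace A" if "A \<in> carrier_mat n n"
  using that by (simp add: mtrace_def sum_distrib_left)

lemma mtrace_one: "mtrace (1\<^sub>m n) = of_nat n"
  by (simp add: mtrace_def)

text \<open>The characteristic polynomial is (X - c)^n, so c is its only root, of order n. For n = 0
  it is the constant 1 and there is no root, hence the separate case.\<close>

lemma eig_xlogx_scalar:
  "eig_xlogx (complex_of_real c \<cdot>\<^sub>m 1\<^sub>m n) = real n * (c * log 2 c)"
proof -
  let ?M = "complex_of_real c \<cdot>\<^sub>m 1\<^sub>m n" and ?p = "[:- complex_of_real c, 1:]"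
  have M: "?M \<in> carrier_mat n n" by simp
  have "diag_mat ?M = replicate n (complex_of_real c)"
    by (rule nth_equalityI) (auto simp: diag_mat_def)
  moreover have "upper_triangular ?M" by auto
  ultimately have cp: "char_poly ?M = ?p ^ n"
    using char_poly_upper_triangular[OF M] by simp
  show ?thesis
  proof (cases n)
    case 0
    then show ?thesis unfolding eig_xlogx_def cp by simp
  next
    case (Suc k)
    then have "{\<nu>. poly (?p ^ n) \<nu> = 0} = {complex_of_real c}" by auto
    then show ?thesis unfolding eig_xlogx_def cp by (simp add: order_power_n_n)
  qed
qed

section \<open>Traces of Majorana monomials and the entropy of the maximally mixed reduction\<close>

context majorana
begin

lemma omega_square: "a < 2*N \<Longrightarrow> \<omega> a * \<omega> a = 1\<^sub>m d"
proof -
  assume a: "a < 2*N"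
  have "\<omega> a * \<omega> a + \<omega> a * \<omega> a = 2 \<cdot>\<^sub>m 1\<^sub>m d" using omega_anticommutator[OF a a] by simp
  then have eq: "(\<omega> a * \<omega> a + \<omega> a * \<omega> a) $$ (i,j) = (2 \<cdot>\<^sub>m 1\<^sub>m d) $$ (i,j)" for i j by simp
  have "(\<omega> a * \<omega> a) $$ (i,j) = 1\<^sub>m d $$ (i,j)" if "i < d" "j < d" for i j
    using that a eq[of i j] by (simp del: index_mult_mat(1) split: if_splits)
  then show ?thesis using a by (intro eq_matI) (simp_all del: index_mult_mat(1))
qed

lemma omega_swap:
  assumes "a < 2*N" "b < 2*N" "a \<noteq> b"
  shows "\<omega> a * \<omega> b = (- 1) \<cdot>\<^sub>m (\<omega> b * \<omega> a)"
proof (rule eq_matI)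
  fix i j assume "i < dim_row ((- 1) \<cdot>\<^sub>m (\<omega> b * \<omega> a))" "j < dim_col ((- 1) \<cdot>\<^sub>m (\<omega> b * \<omega> a))"
  then have ij: "i < d" "j < d" using assms by auto
  have "(\<omega> a * \<omega> b + \<omega> b * \<omega> a) $$ (i,j) = (0 \<cdot>\<^sub>m 1\<^sub>m d :: complex mat) $$ (i,j)"
    using omega_anticommutator[OF assms(1,2)] assms(3) by simp
  then show "(\<omega> a * \<omega> b) $$ (i,j) = ((- 1) \<cdot>\<^sub>m (\<omega> b * \<omega> a)) $$ (i,j)"
    using ij assms by (simp add: eq_neg_iff_add_eq_0 del: index_mult_mat(1))
qed (use assms in auto)

text \<open>Each entry other than \<open>a\<close> contributes one sign; an entry equal to
  \<open>a\<close> commutes.\<close>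

lemma omega_mono_list_commute:
  assumes a: "a < 2*N" and "set js \<subseteq> {..<2*N}"
  shows "\<omega> a * mono_list N \<omega> js
    = (- 1) ^ length (filter (\<lambda>b. b \<noteq> a) js) \<cdot>\<^sub>m (mono_list N \<omega> js * \<omega> a)"
  using assms(2)
proof (induction js)
  case Nil
  have "\<omega> a = 1 \<cdot>\<^sub>m \<omega> a" by (rule eq_matI) auto
  then show ?case using omega_carrier[OF a] by simp
next
  case (Cons b js)
  then have b: "b < 2*N" and js: "set js \<subseteq> {..<2*N}" by auto
  let ?M = "mono_list N \<omega> js" and ?s = "(- 1) ^ length (filter (\<lambda>b. b \<noteq> a) js) :: complex"
  note M = mono_list_carrier[OF js] and ca = omega_carrier[OF a] and cb = omega_carrier[OF b]
  have ab: "\<omega> a * \<omega> b = (if b \<noteq> a then - 1 else 1) \<cdot>\<^sub>m (\<omega> b * \<omega> a)"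
    using omega_swap[OF a b] by auto
  have "\<omega> a * mono_list N \<omega> (b # js) = (\<omega> a * \<omega> b) * ?M"
    using assoc_mult_mat[OF ca cb M] by simp
  also have "\<dots> = (if b \<noteq> a then - 1 else 1) \<cdot>\<^sub>m (\<omega> b * (\<omega> a * ?M))"
    unfolding ab using assoc_mult_mat[OF cb ca M]
      mult_smult_assoc_mat[OF mult_carrier_mat[OF cb ca] M] by simp
  also have "\<omega> b * (\<omega> a * ?M) = ?s \<cdot>\<^sub>m (\<omega> b * (?M * \<omega> a))"
    unfolding Cons.IH[OF js] by (rule mult_smult_distrib[OF cb mult_carrier_mat[OF M ca]])
  also have "\<omega> b * (?M * \<omega> a) = mono_list N \<omega> (b # js) * \<omega> a"
    using assoc_mult_mat[OF cb M ca] by simp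
  finally show ?case
    using a b js by (intro eq_matI) (auto simp del: index_mult_mat(1))
qed

text \<open>Some involution \<open>\<omega> a\<close> anticommutes with the monomial; conjugation by
  it preserves the trace and reverses the monomial's sign. For even |S| any a in S works, for odd
  |S| any a outside S.\<close>

lemma mtrace_mono:
  assumes "S \<subseteq> {..<2*N}" "S \<noteq> {}"
  shows "mtrace (mono N \<omega> S) = 0"
proof -
  have fin: "finite S" using assms(1) by (rule finite_subset) simp
  let ?js = "sorted_list_of_set S"
  have js: "set ?js \<subseteq> {..<2*N}" using assms fin by simp
  have len: "length (filter (\<lambda>b. b \<noteq> a) ?js) = card (S - {a})" for a
    using fin distinct_card[of "filter (\<lambda>b. b \<noteq> a) ?js"] by (simp add: set_diff_eq)
  obtain a where a: "a < 2*N" "odd (card (S - {a}))"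
  proof (cases "even (card S)")
    case True
    obtain a where "a \<in> S" using assms by blast
    moreover have "card S \<noteq> 0" using assms fin by simp
    ultimately show ?thesis using that[of a] True assms by (auto simp: card_Diff_singleton)
  next
    case False
    \<comment> \<open>The full index set has the even cardinality 2N, so a set of odd size misses
      some index.\<close>
    then have "S \<noteq> {..<2*N}" by auto
    then obtain a where "a < 2*N" "a \<notin> S" using assms by blast
    then show ?thesis using that[of a] False by simp
  qed
  let ?M = "mono_list N \<omega> ?js"
  note M = mono_list_carrier[OF js] and ca = omega_carrier[OF a(1)]
  have ac: "\<omega> a * ?M = (- 1) \<cdot>\<^sub>m (?M * \<omega> a)"
    using omega_mono_list_commute[OF a(1) js] a(2) unfolding len by simp
  have "mtrace ?M = mtrace (\<omega> a * (\<omega> a * ?M))"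
    using assoc_mult_mat[OF ca ca M] omega_square[OF a(1)] left_mult_one_mat[OF M] by simp
  also have "\<dots> = mtrace ((\<omega> a * ?M) * \<omega> a)"
    by (rule mtrace_mult_commute[OF ca mult_carrier_mat[OF ca M]])
  also have "(\<omega> a * ?M) * \<omega> a = (- 1) \<cdot>\<^sub>m (?M * (\<omega> a * \<omega> a))"
    unfolding ac using mult_smult_assoc_mat[OF mult_carrier_mat[OF M ca] ca, of "- 1"]
      assoc_mult_mat[OF M ca ca] by simp
  also have "mtrace \<dots> = - mtrace ?M"
    unfolding omega_square[OF a(1)] using mtrace_smult[OF M, of "- 1"] right_mult_one_mat[OF M] by simp
  finally show ?thesis unfolding mono_def by simp
qed

lemma mono_empty: "mono N \<omega> {} = 1\<^sub>m d"
  by (simp add: mono_def)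

lemma mono_carrier: "S \<subseteq> {..<2*N} \<Longrightarrow> mono N \<omega> S \<in> carrier_mat d d"
  unfolding mono_def
  by (rule mono_list_carrier) (metis finite_lessThan finite_subset set_sorted_list_of_set)

text \<open>The reduced density is 2^(-n) times the identity with n = |B|/2. By linearity the
  hypothesis on monomials extends to the whole algebra of B, on which this density reproduces the
  normalized trace.\<close>

lemma reduced_entropy_maximally_mixed:
  assumes B: "B \<subseteq> {..<2*N}" and "even (card B)" and \<psi>: "\<psi> \<in> carrier_vec d"
    and mixed: "reduced_maximally_mixed N \<omega> B \<psi>"
  shows "reduced_entropy_is N \<omega> B \<psi> (real (card B) / 2)"
proof -
  define n where "n = card B div 2"
  have n: "real (card B) / 2 = real n" using \<open>even (card B)\<close> by (auto simp: n_def)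
  have fin: "finite B" using B by (rule finite_subset) simp
  define c where "c = 2 powr (- real n)"
  define \<rho> where "\<rho> = complex_of_real c \<cdot>\<^sub>m 1\<^sub>m d"
  have in_alg: "in_algebra N \<omega> B \<rho>"
    unfolding in_algebra_def
  proof (intro exI eq_matI)
    \<comment> \<open>The identity is the monomial of the empty set, which therefore carries the
      only nonzero coefficient.\<close>
    let ?c = "\<lambda>S :: nat set. if S = {} then complex_of_real c else 0"
    fix r k assume "r < dim_row (mat (fock_dim N) (fock_dim N)
        (\<lambda>(r,k). \<Sum>S\<in>Pow B. ?c S * (mono N \<omega> S $$ (r,k))))"
      "k < dim_col (mat (fock_dim N) (fock_dim N)
        (\<lambda>(r,k). \<Sum>S\<in>Pow B. ?c S * (mono N \<omega> S $$ (r,k))))"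
    then have rk: "r < d" "k < d" by auto
    have "(\<Sum>S\<in>Pow B. ?c S * (mono N \<omega> S $$ (r,k)))
        = (\<Sum>S\<in>Pow B. if S = {} then complex_of_real c * (mono N \<omega> S $$ (r,k)) else 0)"
      by (intro sum.cong) auto
    also have "\<dots> = complex_of_real c * (1\<^sub>m d $$ (r,k))"
      using fin by (simp add: mono_empty)
    finally show "\<rho> $$ (r,k) = mat (fock_dim N) (fock_dim N)
        (\<lambda>(r,k). \<Sum>S\<in>Pow B. ?c S * (mono N \<omega> S $$ (r,k))) $$ (r,k)"
      using rk by (simp add: \<rho>_def)
  qed (auto simp: \<rho>_def)
  have dens: "alg_trace N B (\<rho> * X) = expect \<psi> X" if alg: "in_algebra N \<omega> B X" for X
  proof -
    obtain x where X: "X = mat d d (\<lambda>(r,k). \<Sum>S\<in>Pow B. x S * (mono N \<omega> S $$ (r,k)))"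
      using alg unfolding in_algebra_def by blast
    have Xc: "X \<in> carrier_mat d d" by (simp add: X)
    have mc: "mono N \<omega> S \<in> carrier_mat d d" if "S \<in> Pow B" for S
      using that B by (intro mono_carrier) auto
    have trX: "mtrace X = (\<Sum>S\<in>Pow B. x S * mtrace (mono N \<omega> S))"
    proof -
      have "mtrace X = (\<Sum>i<d. \<Sum>S\<in>Pow B. x S * mono N \<omega> S $$ (i,i))"
        by (simp add: X mtrace_def)
      also have "\<dots> = (\<Sum>S\<in>Pow B. \<Sum>i<d. x S * mono N \<omega> S $$ (i,i))" by (rule sum.swap)
      also have "\<dots> = (\<Sum>S\<in>Pow B. x S * mtrace (mono N \<omega> S))"
        by (intro sum.cong refl) (simp add: mtrace_def sum_distrib_left carrier_matD(1)[OF mc])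
      finally show ?thesis .
    qed
    have expect_sum: "expect \<psi> Y = (\<Sum>r<d. \<Sum>k<d. cnj (\<psi> $ r) * \<psi> $ k * Y $$ (r,k))"
      if "Y \<in> carrier_mat d d" for Y
      using that \<psi>
      by (simp add: expect_def scalar_prod_def atLeast0LessThan sum_distrib_left mult_ac)
    have "expect \<psi> X = (\<Sum>r<d. \<Sum>k<d. \<Sum>S\<in>Pow B. cnj (\<psi> $ r) * \<psi> $ k * (x S * mono N \<omega> S $$ (r,k)))"
      unfolding expect_sum[OF Xc] by (simp add: X sum_distrib_left)
    also have "\<dots> = (\<Sum>r<d. \<Sum>S\<in>Pow B. \<Sum>k<d. cnj (\<psi> $ r) * \<psi> $ k * (x S * mono N \<omega> S $$ (r,k)))"
      by (intro sum.cong refl sum.swap)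
    also have "\<dots> = (\<Sum>S\<in>Pow B. \<Sum>r<d. \<Sum>k<d. cnj (\<psi> $ r) * \<psi> $ k * (x S * mono N \<omega> S $$ (r,k)))"
      by (rule sum.swap)
    also have "\<dots> = (\<Sum>S\<in>Pow B. x S * expect \<psi> (mono N \<omega> S))"
      using mc by (intro sum.cong refl) (simp add: expect_sum sum_distrib_left mult_ac)
    also have "\<dots> = (\<Sum>S\<in>Pow B. x S * (mtrace (mono N \<omega> S) / of_nat d))"
      using mixed unfolding reduced_maximally_mixed_def by (intro sum.cong) auto
    also have "\<dots> = mtrace X / of_nat d"
      unfolding trX by (simp add: sum_divide_distrib)
    finally have ex: "expect \<psi> X = mtrace X / of_nat d" .
    have "\<rho> * X = complex_of_real c \<cdot>\<^sub>m X"
      unfolding \<rho>_def using mult_smult_assoc_mat[OF one_carrier_mat Xc] left_mult_one_mat[OF Xc] by simp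
    then have "alg_trace N B (\<rho> * X) = complex_of_real (2 powr (real n - real N) * c) * mtrace X"
      by (simp add: alg_trace_def mtrace_smult[OF Xc] n_def)
    \<comment> \<open>The weight 2^(n - N) of the algebra trace and the density 2^(-n) combine to
      2^(-N), one over the dimension of Fock space.\<close>
    also have "2 powr (real n - real N) * c = 1 / real d"
      unfolding c_def powr_add[symmetric]
      by (simp add: fock_dim_def powr_minus powr_realpow inverse_eq_divide)
    finally show ?thesis unfolding ex by simp
  qed
  \<comment> \<open>\<open>eig_xlogx\<close> counts all 2^N eigenvalues on Fock space; the prefactor
    2^(n - N) leaves 2^n copies of 2^(-n), each with logarithm -n.\<close>
  have "- (2 powr (real n - real N)) * eig_xlogx \<rho>
      = 2 powr (real n - real N) * real d * c * real n"
    unfolding \<rho>_def eig_xlogx_scalar by (simp add: c_def)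
  also have "2 powr (real n - real N) * real d * c = 1"
    unfolding c_def fock_dim_def
    by (simp add: powr_realpow[symmetric] powr_add[symmetric])
  finally have "real n = - (2 powr (real n - real N)) * eig_xlogx \<rho>" by simp
  then show ?thesis
    unfolding reduced_entropy_is_def reduced_density_def n using in_alg dens
    unfolding n_def by blast
qed

end

context gaussian_relation
begin

text \<open>In the Wick expansion along the least index of a nonempty S, every two-point factor
  joins two distinct indices of B and vanishes. The trace of such a monomial vanishes as
  well.\<close>

lemma reduced_maximally_mixed_E:
  assumes B: "B \<subseteq> {..<2*N}" and J: "\<And>a b. a \<in> B \<Longrightarrow> b \<in> B \<Longrightarrow> J a b = 0"
  shows "reduced_maximally_mixed N \<omega> B E"
  unfolding reduced_maximally_mixed_def
proof (intro allI impI)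
  fix S assume S: "S \<subseteq> B"
  then have SN: "S \<subseteq> {..<2*N}" using B by blast
  then have fin: "finite S" by (rule finite_subset) simp
  show "expect E (mono N \<omega> S) = mtrace (mono N \<omega> S) / of_nat d"
  proof (cases "S = {}")
    case True
    have "d \<noteq> 0" by (simp add: fock_dim_def)
    then show ?thesis using True E_unit by (simp add: mono_empty mtrace_one expect_one)
  next
    case False
    then obtain a xs where js: "sorted_list_of_set S = a # xs"
      using fin by (metis list.exhaust sorted_list_of_set_eq_Nil_iff)
    have set_js: "set (a # xs) = S" and dist: "distinct (a # xs)"
      unfolding js[symmetric] using fin by auto
    have "expect E (mono_list N \<omega> (a # xs)) = 0"
    proof (subst expect_mono_list_Cons)
      show "a < 2*N" "set xs \<subseteq> {..<2*N}" using set_js SN by auto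
      have "two_point a (xs ! i) = 0" if "i < length xs" for i
      proof -
        have "xs ! i \<in> set xs" using that by simp
        moreover have "a \<notin> set xs" using dist by simp
        ultimately show ?thesis using J[of a "xs ! i"] set_js S by (auto simp: two_point_def)
      qed
      then show "(\<Sum>i<length xs. (-1)^i * two_point a (xs ! i)
         * expect E (mono_list N \<omega> (take i xs @ drop (Suc i) xs))) = 0" by simp
    qed
    then show ?thesis using mtrace_mono[OF SN False] unfolding mono_def js by simp
  qed
qed

end

section \<open>Energy eigenstates\<close>

context majorana_frame
begin

lemma gamma_index:
  assumes "v \<in> carrier_vec d" "r < d"
  shows "\<gamma> k v $ r = (\<Sum>j<2*N. complex_of_real (Q k j) * (\<omega> j *\<^sub>v v) $ r)"
  unfolding \<gamma>_def by (rule lincomb_index[OF assms])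

text \<open>Applying \<open>\<gamma> (2*k)\<close> to the eigenvalue equation removes one factor of
  \<open>Z k\<close>. The second identity is the first one multiplied by
  \<open>\<i> * z\<close>.\<close>

lemma Z_eigenvector_gamma:
  assumes k: "k < N" and v: "v \<in> carrier_vec d" and r: "r < d"
    and ev: "Z k v = z \<cdot>\<^sub>v v" and z: "z * z = 1"
  shows "\<i> * \<gamma> (2*k+1) v $ r = z * \<gamma> (2*k) v $ r"
    and "\<i> * \<gamma> (2*k) v $ r = - z * \<gamma> (2*k+1) v $ r"
proof -
  have "\<gamma> (2*k) (Z k v) = \<i> \<cdot>\<^sub>v \<gamma> (2*k+1) v"
    unfolding Z_def using k v by (simp add: gamma_smult gamma_square)
  then have "\<i> \<cdot>\<^sub>v \<gamma> (2*k+1) v = z \<cdot>\<^sub>v \<gamma> (2*k) v"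
    unfolding ev using v by (simp add: gamma_smult)
  then have "(\<i> \<cdot>\<^sub>v \<gamma> (2*k+1) v) $ r = (z \<cdot>\<^sub>v \<gamma> (2*k) v) $ r" by simp
  then show eq: "\<i> * \<gamma> (2*k+1) v $ r = z * \<gamma> (2*k) v $ r" using v r by simp
  have "\<i> * \<gamma> (2*k) v $ r = \<i> * z * (z * \<gamma> (2*k) v $ r)"
    using z by (simp add: mult.assoc[symmetric])
  also have "\<dots> = - z * \<gamma> (2*k+1) v $ r"
    unfolding eq[symmetric] by (simp add: mult_ac)
  finally show "\<i> * \<gamma> (2*k) v $ r = - z * \<gamma> (2*k+1) v $ r" .
qed

text \<open>A weighted sum of wedge products of paired rows. With weights \<open>e\<close> it is the
  coupling matrix, with the signs of the \<open>Z k\<close> as weights the covariance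
  matrix.\<close>

definition pairing :: "(nat \<Rightarrow> real) \<Rightarrow> nat \<Rightarrow> nat \<Rightarrow> real" where
  "pairing c a b = (\<Sum>k<N. c k * (Q (2*k) a * Q (2*k+1) b - Q (2*k+1) a * Q (2*k) b))"

lemma pairing_sum:
  "(\<Sum>b<2*N. complex_of_real (pairing c a b) * g b)
    = (\<Sum>k<N. complex_of_real (c k) *
        (complex_of_real (Q (2*k) a) * (\<Sum>b<2*N. complex_of_real (Q (2*k+1) b) * g b)
         - complex_of_real (Q (2*k+1) a) * (\<Sum>b<2*N. complex_of_real (Q (2*k) b) * g b)))"
proof -
  have "(\<Sum>b<2*N. complex_of_real (pairing c a b) * g b)
    = (\<Sum>b<2*N. \<Sum>k<N. complex_of_real (c k) *
        (complex_of_real (Q (2*k) a) * (complex_of_real (Q (2*k+1) b) * g b)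
         - complex_of_real (Q (2*k+1) a) * (complex_of_real (Q (2*k) b) * g b)))"
    unfolding pairing_def of_real_sum sum_distrib_right
    by (intro sum.cong refl) (simp add: algebra_simps)
  also have "\<dots> = (\<Sum>k<N. \<Sum>b<2*N. complex_of_real (c k) *
        (complex_of_real (Q (2*k) a) * (complex_of_real (Q (2*k+1) b) * g b)
         - complex_of_real (Q (2*k+1) a) * (complex_of_real (Q (2*k) b) * g b)))"
    by (rule sum.swap)
  finally show ?thesis
    by (simp only: sum_distrib_left sum_subtractf right_diff_distrib)
qed

text \<open>In the rotated basis the relation couples only the two members of a pair, where it is
  the eigenvalue equation of \<open>Z k\<close>; since each sign squares to one, rotating back
  returns \<open>\<omega> a\<close>.\<close>

lemma Z_eigenvector_gaussian_relation:
  assumes E: "E \<in> carrier_vec d" "E \<bullet>c E = 1"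
    and \<sigma>: "\<And>k. k < N \<Longrightarrow> \<sigma> k * \<sigma> k = 1"
    and ev: "\<And>k. k < N \<Longrightarrow> Z k E = complex_of_real (\<sigma> k) \<cdot>\<^sub>v E"
  shows "gaussian_relation N \<omega> E (pairing \<sigma>)"
proof (unfold_locales)
  fix a r assume a: "a < 2*N" and r: "r < d"
  define G where "G k = \<gamma> k E $ r" for k
  define g where "g j = (\<omega> j *\<^sub>v E) $ r" for j
  have Gg: "G k = (\<Sum>j<2*N. complex_of_real (Q k j) * g j)" for k
    unfolding G_def g_def by (rule gamma_index[OF E(1) r])
  have \<sigma>c: "complex_of_real (\<sigma> k) * complex_of_real (\<sigma> k) = 1" if "k < N" for k
    unfolding of_real_mult[symmetric] \<sigma>[OF that] by simp
  have "\<i> * (\<Sum>b<2*N. complex_of_real (pairing \<sigma> a b) * g b)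
    = (\<Sum>k<N. complex_of_real (\<sigma> k) * (complex_of_real (Q (2*k) a) * (\<i> * G (2*k+1))
        - complex_of_real (Q (2*k+1) a) * (\<i> * G (2*k))))"
    unfolding pairing_sum Gg[symmetric] sum_distrib_left
    by (intro sum.cong refl) (simp add: algebra_simps)
  also have "\<dots> = (\<Sum>k<N. complex_of_real (Q (2*k) a) * G (2*k) + complex_of_real (Q (2*k+1) a) * G (2*k+1))"
  proof (intro sum.cong refl)
    fix k assume "k \<in> {..<N}"
    then have k: "k < N" by simp
    let ?s = "complex_of_real (\<sigma> k)"
    have G1: "\<i> * G (2*k+1) = ?s * G (2*k)" and G2: "\<i> * G (2*k) = - ?s * G (2*k+1)"
      unfolding G_def using Z_eigenvector_gamma[OF k E(1) r ev[OF k] \<sigma>c[OF k]] by auto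
    have "?s * (complex_of_real (Q (2*k) a) * (?s * G (2*k)) - complex_of_real (Q (2*k+1) a) * (- ?s * G (2*k+1)))
      = (?s * ?s) * (complex_of_real (Q (2*k) a) * G (2*k) + complex_of_real (Q (2*k+1) a) * G (2*k+1))"
      by (simp add: algebra_simps)
    then show "?s * (complex_of_real (Q (2*k) a) * (\<i> * G (2*k+1)) - complex_of_real (Q (2*k+1) a) * (\<i> * G (2*k)))
      = complex_of_real (Q (2*k) a) * G (2*k) + complex_of_real (Q (2*k+1) a) * G (2*k+1)"
      unfolding G1 G2 \<sigma>c[OF k] by simp
  qed
  also have "\<dots> = (\<Sum>k<2*N. complex_of_real (Q k a) * G k)"
    by (rule sum_lessThan_double[symmetric])
  also have "\<dots> = (\<Sum>k<2*N. \<Sum>j<2*N. complex_of_real (Q k a * Q k j) * g j)"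
    unfolding Gg by (simp add: sum_distrib_left mult.assoc)
  also have "\<dots> = (\<Sum>j<2*N. \<Sum>k<2*N. complex_of_real (Q k a * Q k j) * g j)"
    by (rule sum.swap)
  \<comment> \<open>Orthonormality of the columns of \<open>Q\<close> undoes the rotation.\<close>
  also have "\<dots> = (\<Sum>j<2*N. if j = a then g j else 0)"
    unfolding sum_distrib_right[symmetric] of_real_sum[symmetric]
    using a by (intro sum.cong refl) (simp add: Q_cols)
  also have "\<dots> = g a" using a by simp
  finally show "(\<omega> a *\<^sub>v E) $ r = \<i> * (\<Sum>b<2*N. complex_of_real (pairing \<sigma> a b) * (\<omega> b *\<^sub>v E) $ r)"
    unfolding g_def ..
qed (use E in auto)

text \<open>Contracting the normal form of \<open>h\<close> with the Majorana operators leaves one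
  commutator of \<open>\<gamma> (2*k)\<close> and \<open>\<gamma> (2*k+1)\<close> per pair.\<close>

lemma majorana_hamiltonian_eigenvector:
  assumes E: "E \<in> carrier_vec d"
    and h: "\<And>a b. a < 2*N \<Longrightarrow> b < 2*N \<Longrightarrow> h a b = pairing e a b"
    and ev: "\<And>k. k < N \<Longrightarrow> Z k E = z k \<cdot>\<^sub>v E"
  shows "majorana_hamiltonian N \<omega> h *\<^sub>v E = ((\<Sum>k<N. complex_of_real (e k) * z k) / 2) \<cdot>\<^sub>v E"
proof (rule eq_vecI)
  fix r assume "r < dim_vec (((\<Sum>k<N. complex_of_real (e k) * z k) / 2) \<cdot>\<^sub>v E)"
  then have r: "r < d" using E by simp
  define g where "g a b = (\<omega> a *\<^sub>v (\<omega> b *\<^sub>v E)) $ r" for a b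
  have ww: "(\<Sum>c<d. (\<omega> a * \<omega> b) $$ (r,c) * E $ c) = g a b" if "a < 2*N" "b < 2*N" for a b
  proof -
    have "(\<Sum>c<d. (\<omega> a * \<omega> b) $$ (r,c) * E $ c) = ((\<omega> a * \<omega> b) *\<^sub>v E) $ r"
      using that E r by (simp add: scalar_prod_def[of "row (\<omega> a * \<omega> b) r"] atLeast0LessThan)
    then show ?thesis
      unfolding g_def using assoc_mult_mat_vec[OF omega_carrier omega_carrier E] that by simp
  qed
  have "(majorana_hamiltonian N \<omega> h *\<^sub>v E) $ r
    = (\<Sum>c<d. \<i> / 4 * (\<Sum>a<2*N. \<Sum>b<2*N. complex_of_real (h a b) * ((\<omega> a * \<omega> b) $$ (r,c))) * E $ c)"
    using E r by (simp add: majorana_hamiltonian_def scalar_prod_def atLeast0LessThan)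
  also have "\<dots> = \<i> / 4 * (\<Sum>c<d. \<Sum>a<2*N. \<Sum>b<2*N. complex_of_real (h a b) * ((\<omega> a * \<omega> b) $$ (r,c) * E $ c))"
    by (simp only: sum_distrib_left sum_distrib_right mult.assoc)
  also have "(\<Sum>c<d. \<Sum>a<2*N. \<Sum>b<2*N. complex_of_real (h a b) * ((\<omega> a * \<omega> b) $$ (r,c) * E $ c))
    = (\<Sum>a<2*N. \<Sum>b<2*N. \<Sum>c<d. complex_of_real (h a b) * ((\<omega> a * \<omega> b) $$ (r,c) * E $ c))"
    by (subst sum.swap) (intro sum.cong refl sum.swap)
  also have "\<dots> = (\<Sum>a<2*N. \<Sum>b<2*N. complex_of_real (pairing e a b) * g a b)"
    unfolding sum_distrib_left[symmetric] by (intro sum.cong refl) (simp add: ww h)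
  also have "\<dots> = (\<Sum>k<N. complex_of_real (e k) * (\<gamma> (2*k) (\<gamma> (2*k+1) E) $ r - \<gamma> (2*k+1) (\<gamma> (2*k) E) $ r))"
  proof -
    have gg: "(\<Sum>a<2*N. complex_of_real (Q k a) * (\<Sum>b<2*N. complex_of_real (Q l b) * g a b))
        = \<gamma> k (\<gamma> l E) $ r" for k l
    proof -
      have "\<gamma> k (\<gamma> l E) $ r = (\<Sum>a<2*N. complex_of_real (Q k a) * (\<omega> a *\<^sub>v \<gamma> l E) $ r)"
        using E r by (intro gamma_index) auto
      also have "\<dots> = (\<Sum>a<2*N. complex_of_real (Q k a) * (\<Sum>b<2*N. complex_of_real (Q l b) * g a b))"
        unfolding \<gamma>_def g_def using E r
        by (intro sum.cong refl arg_cong2[of _ _ _ _ "(*)"] mult_lincomb_index) auto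
      finally show ?thesis ..
    qed
    have "(\<Sum>a<2*N. \<Sum>b<2*N. complex_of_real (pairing e a b) * g a b)
      = (\<Sum>k<N. \<Sum>a<2*N. complex_of_real (e k) *
        (complex_of_real (Q (2*k) a) * (\<Sum>b<2*N. complex_of_real (Q (2*k+1) b) * g a b)
         - complex_of_real (Q (2*k+1) a) * (\<Sum>b<2*N. complex_of_real (Q (2*k) b) * g a b)))"
      unfolding pairing_sum by (rule sum.swap)
    then show ?thesis
      unfolding sum_distrib_left[symmetric] sum_subtractf gg .
  qed
  also have "\<i> / 4 * \<dots> = (\<Sum>k<N. complex_of_real (e k) * z k) / 2 * E $ r"
  proof -
    \<comment> \<open>The commutator doubles the product, which together with the factor 1/4 of the
      Hamiltonian accounts for the 1/2 in the energy.\<close>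
    have "\<i> * (\<gamma> (2*k) (\<gamma> (2*k+1) E) $ r - \<gamma> (2*k+1) (\<gamma> (2*k) E) $ r) = 2 * z k * E $ r"
      if k: "k < N" for k
    proof -
      have "\<gamma> (2*k+1) (\<gamma> (2*k) E) = (- 1) \<cdot>\<^sub>v \<gamma> (2*k) (\<gamma> (2*k+1) E)"
        using k E by (intro gamma_swap) auto
      then have "\<gamma> (2*k+1) (\<gamma> (2*k) E) $ r = - \<gamma> (2*k) (\<gamma> (2*k+1) E) $ r"
        using E r by simp
      moreover have "\<i> * \<gamma> (2*k) (\<gamma> (2*k+1) E) $ r = z k * E $ r"
        using arg_cong[OF ev[OF k], of "\<lambda>v. v $ r"] E r by (simp add: Z_def)
      ultimately show ?thesis by (simp add: algebra_simps)
    qed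
    then have "(\<Sum>k<N. complex_of_real (e k) *
        (\<i> * (\<gamma> (2*k) (\<gamma> (2*k+1) E) $ r - \<gamma> (2*k+1) (\<gamma> (2*k) E) $ r)))
      = (\<Sum>k<N. complex_of_real (e k) * (2 * z k * E $ r))"
      by (intro sum.cong refl) simp
    then have "\<i> * (\<Sum>k<N. complex_of_real (e k) *
        (\<gamma> (2*k) (\<gamma> (2*k+1) E) $ r - \<gamma> (2*k+1) (\<gamma> (2*k) E) $ r))
      = 2 * ((\<Sum>k<N. complex_of_real (e k) * z k) * E $ r)"
      by (simp only: sum_distrib_left sum_distrib_right mult_ac)
    then show ?thesis by simp
  qed
  finally show "(majorana_hamiltonian N \<omega> h *\<^sub>v E) $ r
    = (((\<Sum>k<N. complex_of_real (e k) * z k) / 2) \<cdot>\<^sub>v E) $ r" using E r by simp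
qed (use E in \<open>simp add: majorana_hamiltonian_def\<close>)

lemma Z_eigenvectors_orthogonal:
  assumes "k < N" "v \<in> carrier_vec d" "w \<in> carrier_vec d"
    and "Z k v = complex_of_real x \<cdot>\<^sub>v v" "Z k w = complex_of_real y \<cdot>\<^sub>v w" "x \<noteq> y"
  shows "v \<bullet>c w = 0"
proof -
  have "complex_of_real x * (v \<bullet>c w) = complex_of_real y * (v \<bullet>c w)"
    using Z_adjoint[OF assms(1-3)] assms(2,3) unfolding assms(4,5)
    by (simp add: conjugate_smult_vec)
  then show ?thesis using assms(6) by simp
qed

end

theorem theorem1:
  fixes N :: nat
    and \<omega> :: "nat \<Rightarrow> complex mat"
    and h :: "nat \<Rightarrow> nat \<Rightarrow> real"
    and A B :: "nat set"
  assumes maj: "majorana_family N \<omega>"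
    and antisym: "\<forall>\<alpha><2*N. \<forall>\<beta><2*N. h \<alpha> \<beta> = - h \<beta> \<alpha>"
    and part: "A \<union> B = {..<2*N}" "A \<inter> B = {}"
    and even: "even (card A)" "even (card B)"
    and AB: "card A \<ge> card B"
    and bip: "\<forall>\<alpha><2*N. \<forall>\<beta><2*N.
                 \<not> ((\<alpha> \<in> A \<and> \<beta> \<in> B) \<or> (\<alpha> \<in> B \<and> \<beta> \<in> A)) \<longrightarrow> h \<alpha> \<beta> = 0"
  shows "\<exists>E :: bool list \<Rightarrow> complex vec.
     (\<forall>s t. length s = N \<longrightarrow> length t = N \<longrightarrow>
        E s \<bullet>c E t = (if s = t then 1 else 0)) \<and>
     (\<forall>s. length s = N \<longrightarrow>
        pure_gaussian N \<omega> (E s) \<and>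
        (\<exists>e. majorana_hamiltonian N \<omega> h *\<^sub>v E s = e \<cdot>\<^sub>v E s) \<and>
        reduced_maximally_mixed N \<omega> B (E s) \<and>
        (\<forall>j\<in>B. \<forall>k\<in>B. covariance \<omega> (E s) j k = 0) \<and>
        reduced_entropy_is N \<omega> B (E s) (real (card B) / 2))"
proof -
  obtain Q e where
    rows: "\<And>k l. k < 2*N \<Longrightarrow> l < 2*N \<Longrightarrow> (\<Sum>j<2*N. Q k j * Q l j) = (if k = l then 1 else 0)" and
    cols: "\<And>i j. i < 2*N \<Longrightarrow> j < 2*N \<Longrightarrow> (\<Sum>k<2*N. Q k i * Q k j) = (if i = j then 1 else 0)" and
    QB: "\<And>k b. k < N \<Longrightarrow> b \<in> B \<Longrightarrow> Q (2*k) b = 0" and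
    hQ: "\<And>a b. a < 2*N \<Longrightarrow> b < 2*N \<Longrightarrow>
       h a b = (\<Sum>k<N. e k * (Q (2*k) a * Q (2*k+1) b - Q (2*k+1) a * Q (2*k) b))"
    using bipartite_normal_form[OF antisym part AB bip] by blast
  interpret majorana_frame N \<omega> Q
    by unfold_locales (use maj rows cols in auto)
  have BN: "B \<subseteq> {..<2*N}" using part(1) by blast
  \<comment> \<open>\<open>True\<close> means Z = -1, an occupied mode in the parity reading of
    \<open>Z\<close>.\<close>
  define \<sigma> :: "bool list \<Rightarrow> nat \<Rightarrow> real" where "\<sigma> s k = (if s ! k then - 1 else 1)" for s k
  have \<sigma>2: "\<sigma> s k * \<sigma> s k = 1" for s k by (simp add: \<sigma>_def)
  \<comment> \<open>The choice covers lists of every length: if \<open>s\<close> is too short,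
    \<open>s ! k\<close> is unspecified, but \<open>\<sigma> s k\<close> is still a sign.\<close>
  have "\<exists>v. v \<in> carrier_vec d \<and> v \<bullet>c v = 1 \<and> (\<forall>k<N. Z k v = complex_of_real (\<sigma> s k) \<cdot>\<^sub>v v)" for s
    by (rule Z_joint_eigenvector[of "\<lambda>k. complex_of_real (\<sigma> s k)"]) (auto simp: \<sigma>_def)
  then obtain E where E: "\<And>s. E s \<in> carrier_vec d" "\<And>s. E s \<bullet>c E s = 1"
    and ev: "\<And>s k. k < N \<Longrightarrow> Z k (E s) = complex_of_real (\<sigma> s k) \<cdot>\<^sub>v E s"
    by metis
  have JB: "pairing (\<sigma> s) a b = 0" if "a \<in> B" "b \<in> B" for s a b
    using that by (simp add: pairing_def QB)
  show ?thesis
  proof (intro exI[of _ E] conjI allI impI)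
    fix s t :: "bool list" assume st: "length s = N" "length t = N"
    show "E s \<bullet>c E t = (if s = t then 1 else 0)"
    proof (cases "s = t")
      case False
      \<comment> \<open>Different lists disagree at some mode, and the Hermitian operator
        \<open>Z k\<close> of that mode separates the two vectors.\<close>
      then obtain k where "k < N" "s ! k \<noteq> t ! k" using st list_eq_iff_nth_eq[of s t] by auto
      then have "E s \<bullet>c E t = 0"
        using Z_eigenvectors_orthogonal[OF _ E(1) E(1) ev ev, of k s t] by (simp add: \<sigma>_def)
      then show ?thesis using False by simp
    qed (simp add: E)
  next
    fix s :: "bool list"
    interpret gaussian_relation N \<omega> "E s" "pairing (\<sigma> s)"
      by (rule Z_eigenvector_gaussian_relation[OF E \<sigma>2 ev])
    show "pure_gaussian N \<omega> (E s)" by (rule pure_gaussian_E)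
    show "\<exists>x. majorana_hamiltonian N \<omega> h *\<^sub>v E s = x \<cdot>\<^sub>v E s"
      using majorana_hamiltonian_eigenvector[OF E(1) hQ[folded pairing_def] ev] by blast
    show mixed: "reduced_maximally_mixed N \<omega> B (E s)"
      by (rule reduced_maximally_mixed_E[OF BN JB])
    show "\<forall>j\<in>B. \<forall>k\<in>B. covariance \<omega> (E s) j k = 0"
      using BN by (auto simp: covariance_E JB subset_iff)
    show "reduced_entropy_is N \<omega> B (E s) (real (card B) / 2)"
      by (rule reduced_entropy_maximally_mixed[OF BN even(2) E(1) mixed])
  qed
qed

end
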